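(* If $\dim E=n-1\equiv4\pmod 8$, every non-zero charge spin representation $\rho$ of the Heisenberg algebra $\mathfrak{heis}_b=E^*+E+\mathbb R\mathrm p$ is given, for some sign $\varepsilon\in\{+1,-1\}$, by $$\rho(\mathrm p)=\sqrt2\begin{pmatrix}0&h_1(\mathrm{Id}+\varepsilon\,\mathcal E)\\0&0\end{pmatrix},$$ $$\rho(e)=\frac12\begin{pmatrix}h_3(e)\mathrm{Id}-h_1e+\varepsilon h_1e\,\mathcal E-h_4(e)\,\mathcal E&2\rho_{12}(e)\\0&h_3(e)\mathrm{Id}+h_1e+\varepsilon h_1e\,\mathcal E+h_4(e)\,\mathcal E\end{pmatrix}\qquad(e\in E),$$ where $\rho_{12}\in\mathrm{Hom}_{\mathbb R}(E,\mathrm{End}_{\mathbb R}(S_{0,n-1}))$ is $(\rho_{11},\rho_{22})$-suitable ($\rho_{11},\rho_{22}$ being the diagonal blocks of $\rho$ on $E$) and one of the following holds: (a) $h_1\in\mathbb H$ satisfies $\mathrm{Re}\,h_1\neq0$; $h_3\in\mathrm{Hom}_{\mathbb R}(E,\mathbb H)$ is such that $\mathrm{Im}\,h_3:E\to\mathrm{Im}\,\mathbb H$ has rank at most $1$; and $$h_4(e)=-\varepsilon\,\frac{\mathrm{Im}\,h_1\times\mathrm{Im}\,h_3(e)}{\mathrm{Re}\,h_1};$$ (b) $h_1\in\mathbb H$ satisfies $\mathrm{Re}\,h_1=0$ and $\mathrm{Im}\,h_1\ne0$; $h_3=(h_3^{\mathbb R},h_3^{\mathbb C})\in\mathrm{Hom}_{\mathbb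 R}(E,\mathbb C)$, where $\mathbb C$ is identified with the subspace $\mathbb R\oplus\mathbb R\frac{\mathrm{Im}\,h_1}{|\mathrm{Im}\,h_1|}$ of $\mathbb H$ (so $h_3^{\mathbb R},h_3^{\mathbb C}$ are the two real components); and $h_4\in\mathrm{Hom}_{\mathbb R}(E,\mathbb R)$, where the codomain $\mathbb R$ is identified with some $1$-dimensional subspace of $(\mathrm{Im}\,h_1)^\perp\subset\mathrm{Im}\,\mathbb H$, with $\mathrm{Ker}(h_4)=\mathrm{Ker}(h_3^{\mathbb C})$ if $h_3^{\mathbb C}\neq0$ and $h_4\ne0$.
   Context: $E=\mathbb R^{0,n-1}$ is an $(n-1)$-dimensional real vector space with a negative definite inner product $\langle\cdot,\cdot\rangle$; $e^\flat=\langle e,\cdot\rangle\in E^*$. $b$ is a non-degenerate symmetric bilinear form on $E$ and $B\in\mathrm{End}_{\mathbb R}(E)$ is defined by $b(\cdot,\cdot)=-\langle B\cdot,\cdot\rangle$. The Heisenberg algebra $\mathfrak{heis}_b=E^*+E+\mathbb R\mathrm p$ has as only non-trivial brackets $[e^\flat,f]=b(e,f)\mathrm p$ ($e,f\in E$). $\mathrm{Cl}_{0,n-1}$ is the Clifford algebra of $E$ with convention $v^2=-\langle v,v\rangle$ (so unit vectors of $E$ square to $+1$), $S_{0,n-1}$ is a real irreducible $\mathrm{Cl}_{0,n-1}$-module, on which a vector $e\in E$ acts by Clifford multiplication (denoted again $e$). $\mathcal E$ denotes the action on $S_{0,n-1}$ of the volume form $\omega_{0,n-1}=e_1\cdots e_{n-1}$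 ($e_i$ an orthonormal basis of $E$); for $n-1\equiv4\pmod8$ one has $\mathcal E^2=\mathrm{Id}$ and $\mathcal E$ anticommutes with vectors. (The paper denotes it $E$.) The even Schur algebra $\mathcal C^\circ_{0,n-1}$ is the algebra of endomorphisms of $S_{0,n-1}$ commuting with Clifford multiplication by all vectors; for $n-1\equiv4\pmod8$ it is isomorphic to the quaternions $\mathbb H$, and elements of $\mathbb H$ are regarded as endomorphisms of $S_{0,n-1}$ through such an identification. $\mathrm{Re}$, $\mathrm{Im}$ denote the real and imaginary parts of quaternions, $\mathrm{Im}\,\mathbb H\cong\mathbb R^3$ carries its standard norm $|\cdot|$, orthogonality and vector product $a\times a'=\frac12[a,a']$. Let $\mathfrak m=E+\mathbb R\mathrm p+\mathbb R\mathrm q$ be Minkowski space ($\mathrm p,\mathrm q$ isotropic, orthogonal to $E$, $\langle\mathrm p,\mathrm q\rangle=1$) and $S=S_{1,n}$ the real irreducible $\mathrm{Cl}(\mathfrak m)$-module. It is identified, as a vector space, with $S=S_-+S_+=S_{0,n-1}+S_{0,n-1}$ (endomorphisms written as $2\times2$ block matrices) in such a way that $\mathrm p\wedge e\in\mathfrak{so}(\mathfrak m)$ acts as $\begin{pmatrix}0&\sqrt2\,e\\0&0\end{pmatrix}$. A Lie algebra representation $\rho:\mathfrak{heis}_b\to\mathfrak{gl}_{\mathbb R}(S)$ is called spin if $\rho(e^\flat)=\begin{pmatrix}0&\sqrt2\,Be\\0&0\end{pmatrix}$ for all $e\in E$ (the spin action of $\mathrm p\wedge Be$). It has non-zero charge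 if $\rho(\mathrm p)\neq0$. For fixed $\rho_{11},\rho_{22}\in\mathrm{Hom}_{\mathbb R}(E,\mathrm{End}_{\mathbb R}(S_{0,n-1}))$, a map $\rho_{12}\in\mathrm{Hom}_{\mathbb R}(E,\mathrm{End}_{\mathbb R}(S_{0,n-1}))$ is $(\rho_{11},\rho_{22})$-suitable if the bilinear map $e\otimes f\mapsto\rho_{11}(e)\circ\rho_{12}(f)-\rho_{12}(f)\circ\rho_{22}(e)$ on $E\otimes E$ is symmetric. *)

theory Defs
  imports "HOL-Analysis.Analysis"
begin

(* The negative definite space E is modelled by an arbitrary Euclidean space whose inner
   product is negated. *)

definition neg_inner :: "'e::euclidean_space \<Rightarrow> 'e \<Rightarrow> real" where
  "neg_inner x y = - (x \<bullet> y)"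

definition flat :: "'e::euclidean_space \<Rightarrow> ('e \<Rightarrow>\<^sub>L real)" where
  "flat e = Blinfun (neg_inner e)"

lemma flat_apply [simp]: "blinfun_apply (flat e) f = neg_inner e f"
proof -
  have "neg_inner e = (\<lambda>x. - (e \<bullet> x))"
    by (auto simp: neg_inner_def)
  then have "bounded_linear (neg_inner e)"
    using bounded_linear_minus[OF bounded_linear_inner_right[of e]] by simp
  then show ?thesis
    by (simp add: flat_def bounded_linear_Blinfun_apply)
qed

lemma inj_flat: "inj flat"
proof (rule injI)
  fix x y :: 'a
  assume "flat x = flat y"
  then have "neg_inner x z = neg_inner y z" for z
    by (metis flat_apply)
  then have "x \<bullet> z = y \<bullet> z" for z
    by (simp add: neg_inner_def)
  then show "x = y"
    using vector_eq_rdot by blast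
qed

definition orthonormal_list :: "'e::euclidean_space list \<Rightarrow> bool" where
  "orthonormal_list es \<longleftrightarrow> length es = DIM('e) \<and>
     (\<forall>i < length es. \<forall>j < length es. neg_inner (es ! i) (es ! j) = (if i = j then -1 else 0))"

(* Minkowski space E + R p + R q: the triple (e, s, t) stands for e + s p + t q. *)

type_synonym 'e mink = "'e \<times> real \<times> real"

definition mink_inner :: "'e::euclidean_space mink \<Rightarrow> 'e mink \<Rightarrow> real" where
  "mink_inner = (\<lambda>(e, s, t) (e', s', t'). neg_inner e e' + s * t' + t * s')"

definition mink_vec :: "'e::euclidean_space \<Rightarrow> 'e mink" where
  "mink_vec e = (e, 0, 0)"

definition mink_p :: "'e::euclidean_space mink" where
  "mink_p = (0, 1, 0)"

(* A module over the Clifford algebra of (V, g), with v^2 = - g v v, is given by the action of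
   the vectors, by the universal property.  Modules are finite-dimensional real vector spaces,
   modelled by Euclidean spaces whose inner product plays no role; they are non-zero. *)

definition clifford_module ::
  "('v::real_vector \<Rightarrow> 'v \<Rightarrow> real) \<Rightarrow> ('v \<Rightarrow> ('s::euclidean_space \<Rightarrow>\<^sub>L 's)) \<Rightarrow> bool" where
  "clifford_module g \<gamma> \<longleftrightarrow> linear \<gamma> \<and> (\<forall>v. \<gamma> v o\<^sub>L \<gamma> v = (- g v v) *\<^sub>R id_blinfun)"

definition irreducible_clifford_module ::
  "('v::real_vector \<Rightarrow> 'v \<Rightarrow> real) \<Rightarrow> ('v \<Rightarrow> ('s::euclidean_space \<Rightarrow>\<^sub>L 's)) \<Rightarrow> bool" where
  "irreducible_clifford_module g \<gamma> \<longleftrightarrow> clifford_module g \<gamma> \<and>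
     (\<forall>W. subspace W \<and> (\<forall>v. \<forall>x \<in> W. \<gamma> v x \<in> W) \<longrightarrow> W = {0} \<or> W = UNIV)"

definition volume_action ::
  "('e::euclidean_space \<Rightarrow> ('s::euclidean_space \<Rightarrow>\<^sub>L 's)) \<Rightarrow> 'e list \<Rightarrow> ('s \<Rightarrow>\<^sub>L 's)" where
  "volume_action \<gamma> es = foldr (\<lambda>e T. \<gamma> e o\<^sub>L T) es id_blinfun"

(* Spin action of the element x \<mapsto> g v x w - g w x v of so(V, g): its commutator with the
   Clifford action of x is the Clifford action of g v x w - g w x v. *)

definition spin_wedge ::
  "('v::real_vector \<Rightarrow> ('s::euclidean_space \<Rightarrow>\<^sub>L 's)) \<Rightarrow> 'v \<Rightarrow> 'v \<Rightarrow> ('s \<Rightarrow>\<^sub>L 's)" where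
  "spin_wedge \<Gamma> v w = (1 / 4) *\<^sub>R ((\<Gamma> v o\<^sub>L \<Gamma> w) - (\<Gamma> w o\<^sub>L \<Gamma> v))"

definition schur_algebra ::
  "('e::euclidean_space \<Rightarrow> ('s::euclidean_space \<Rightarrow>\<^sub>L 's)) \<Rightarrow> ('s \<Rightarrow>\<^sub>L 's) set" where
  "schur_algebra \<gamma> = {T. \<forall>e. T o\<^sub>L \<gamma> e = \<gamma> e o\<^sub>L T}"

(* Quaternions as pairs (real part, imaginary part). *)

type_synonym quat = "real \<times> (real ^ 3)"

abbreviation quat_Re :: "quat \<Rightarrow> real" where
  "quat_Re \<equiv> fst"

abbreviation quat_Im :: "quat \<Rightarrow> real ^ 3" where
  "quat_Im \<equiv> snd"

definition quat_mult :: "quat \<Rightarrow> quat \<Rightarrow> quat" where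
  "quat_mult x y =
     (quat_Re x * quat_Re y - quat_Im x \<bullet> quat_Im y,
      quat_Re x *\<^sub>R quat_Im y + quat_Re y *\<^sub>R quat_Im x + cross3 (quat_Im x) (quat_Im y))"

lemma quat_commutator:
  "(1 / 2) *\<^sub>R (quat_mult (0, a) (0, a') - quat_mult (0, a') (0, a)) = (0, cross3 a a')"
  by (simp add: quat_mult_def inner_commute cross3_def vec_eq_iff forall_3)

definition quat_identification :: "(quat \<Rightarrow> ('s::euclidean_space \<Rightarrow>\<^sub>L 's)) \<Rightarrow> ('s \<Rightarrow>\<^sub>L 's) set \<Rightarrow> bool" where
  "quat_identification \<iota> A \<longleftrightarrow> linear \<iota> \<and> \<iota> (1, 0) = id_blinfun \<and>
     (\<forall>x y. \<iota> (quat_mult x y) = \<iota> x o\<^sub>L \<iota> y) \<and> bij_betw \<iota> UNIV A"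

(* The Heisenberg algebra E* + E + R p, with triples (alpha, e, t). *)

type_synonym 'e heis = "('e \<Rightarrow>\<^sub>L real) \<times> 'e \<times> real"

definition heis_dual :: "'e::euclidean_space \<Rightarrow> 'e heis" where
  "heis_dual e = (flat e, 0, 0)"

definition heis_vec :: "'e::euclidean_space \<Rightarrow> 'e heis" where
  "heis_vec e = (0, e, 0)"

definition heis_p :: "'e::euclidean_space heis" where
  "heis_p = (0, 0, 1)"

definition heis_bracket ::
  "('e::euclidean_space \<Rightarrow> 'e \<Rightarrow> real) \<Rightarrow> 'e heis \<Rightarrow> 'e heis \<Rightarrow> 'e heis" where
  "heis_bracket b = (\<lambda>(\<alpha>, e, s) (\<beta>, f, t). (0, 0, b (inv flat \<alpha>) f - b (inv flat \<beta>) e))"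

lemma heis_bracket_dual_vec:
  assumes "bilinear b"
  shows "heis_bracket b (heis_dual e) (heis_vec f) = b e f *\<^sub>R heis_p"
  using assms
  by (simp add: heis_bracket_def heis_dual_def heis_vec_def heis_p_def inv_f_f[OF inj_flat]
      bilinear_rzero)

definition nondegenerate_symmetric_form :: "('e::real_vector \<Rightarrow> 'e \<Rightarrow> real) \<Rightarrow> bool" where
  "nondegenerate_symmetric_form b \<longleftrightarrow> bilinear b \<and> (\<forall>x y. b x y = b y x) \<and>
     (\<forall>x. (\<forall>y. b x y = 0) \<longrightarrow> x = 0)"

definition heis_representation ::
  "('e::euclidean_space \<Rightarrow> 'e \<Rightarrow> real) \<Rightarrow> ('e heis \<Rightarrow> ('t::euclidean_space \<Rightarrow>\<^sub>L 't)) \<Rightarrow> bool" where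
  "heis_representation b \<rho> \<longleftrightarrow> linear \<rho> \<and>
     (\<forall>x y. \<rho> (heis_bracket b x y) = (\<rho> x o\<^sub>L \<rho> y) - (\<rho> y o\<^sub>L \<rho> x))"

(* The endomorphism T is the block matrix with rows (A, B) and (C, D) in the decomposition of
   the space given by the linear isomorphism \<Phi>. *)

definition has_blocks ::
  "('s::euclidean_space \<times> 's \<Rightarrow> 't::euclidean_space) \<Rightarrow> ('t \<Rightarrow>\<^sub>L 't) \<Rightarrow>
   ('s \<Rightarrow>\<^sub>L 's) \<Rightarrow> ('s \<Rightarrow>\<^sub>L 's) \<Rightarrow> ('s \<Rightarrow>\<^sub>L 's) \<Rightarrow> ('s \<Rightarrow>\<^sub>L 's) \<Rightarrow> bool" where
  "has_blocks \<Phi> T A B C D \<longleftrightarrow> (\<forall>x y. T (\<Phi> (x, y)) = \<Phi> (A x + B y, C x + D y))"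

(* Identification of the spinor module of Minkowski space with the sum of two copies of the
   spinor module of E. *)

definition spinor_splitting ::
  "('e::euclidean_space \<Rightarrow> ('s::euclidean_space \<Rightarrow>\<^sub>L 's)) \<Rightarrow>
   ('e mink \<Rightarrow> ('t::euclidean_space \<Rightarrow>\<^sub>L 't)) \<Rightarrow> ('s \<times> 's \<Rightarrow> 't) \<Rightarrow> bool" where
  "spinor_splitting \<gamma> \<Gamma> \<Phi> \<longleftrightarrow> linear \<Phi> \<and> bij \<Phi> \<and>
     (\<forall>e. has_blocks \<Phi> (spin_wedge \<Gamma> mink_p (mink_vec e)) 0 (sqrt 2 *\<^sub>R \<gamma> e) 0 0)"

definition spin_representation ::
  "('e::euclidean_space \<Rightarrow> ('s::euclidean_space \<Rightarrow>\<^sub>L 's)) \<Rightarrow> ('s \<times> 's \<Rightarrow> 't::euclidean_space) \<Rightarrow>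
   ('e \<Rightarrow> 'e \<Rightarrow> real) \<Rightarrow> ('e \<Rightarrow> 'e) \<Rightarrow> ('e heis \<Rightarrow> ('t \<Rightarrow>\<^sub>L 't)) \<Rightarrow> bool" where
  "spin_representation \<gamma> \<Phi> b B \<rho> \<longleftrightarrow> heis_representation b \<rho> \<and>
     (\<forall>e. has_blocks \<Phi> (\<rho> (heis_dual e)) 0 (sqrt 2 *\<^sub>R \<gamma> (B e)) 0 0)"

definition suitable ::
  "('e::euclidean_space \<Rightarrow> ('s::euclidean_space \<Rightarrow>\<^sub>L 's)) \<Rightarrow> ('e \<Rightarrow> ('s \<Rightarrow>\<^sub>L 's)) \<Rightarrow>
   ('e \<Rightarrow> ('s \<Rightarrow>\<^sub>L 's)) \<Rightarrow> bool" where
  "suitable \<rho>11 \<rho>22 \<rho>12 \<longleftrightarrow> linear \<rho>12 \<and>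
     (\<forall>e f. (\<rho>11 e o\<^sub>L \<rho>12 f) - (\<rho>12 f o\<^sub>L \<rho>22 e) =
            (\<rho>11 f o\<^sub>L \<rho>12 e) - (\<rho>12 e o\<^sub>L \<rho>22 f))"

end

theory Submission
  imports Defs
begin

text \<open>
Write \<open>\<rho>(f)\<close>, for a vector \<open>f\<close>, as a block matrix with diagonal blocks \<open>a(f)\<close>, \<open>g(f)\<close>.  The brackets of
vectors with dual vectors force \<open>\<rho>(f)\<close> to be upper triangular and \<open>\<rho>(p)\<close> to have a single block
\<open>sqrt 2 H\<close>, with \<open>e g(f) - a(f) e = (e \<bullet> f) H\<close> for all vectors \<open>e\<close>, \<open>f\<close>
(\<open>spin_representation_blocks\<close>).

Everything else rests on one remark (\<open>even_commutant\<close>): an operator on the spinors which commutes with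
all products of two vectors is \<open>h + k \<omega>\<close> with quaternions \<open>h\<close>, \<open>k\<close> and the volume element \<open>\<omega>\<close>.
Indeed it is a sum of an operator commuting with all vectors and one anticommuting with them, and
multiplication by \<open>\<omega>\<close> turns the second kind into the first.  The remark applies to \<open>H\<close>, because one
can choose \<open>f\<close> orthogonal to any two given vectors (\<open>charge_even\<close>).  It also applies to \<open>a(f)\<close>
after subtraction of a particular solution of the displayed equation
(\<open>diagonal_block_form\<close>), and \<open>g(f)\<close> is then determined.  Hence all diagonal blocks are combinations of \<open>1\<close>, \<open>f\<close>, \<open>\<omega>\<close> and \<open>f \<omega>\<close> with
quaternionic coefficients, and these are unique (\<open>coefficients_unique\<close>).

The remaining brackets then become identities between quaternions.  That \<open>\<rho>(p)\<close> is central means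
\<open>H g(f) = a(f) H\<close>; it gives \<open>h\<^sup>2 = k\<^sup>2\<close> and \<open>h k = k h\<close>, thus \<open>k = \<epsilon> h\<close> with a sign \<open>\<epsilon>\<close>, and one relation
between \<open>h1\<close>, \<open>h3\<close>, \<open>h4\<close>.  That the \<open>a(f)\<close> commute gives two relations between the values of \<open>h3\<close> and \<open>h4\<close>
(\<open>heisenberg_diagonal_blocks\<close>).  In terms of vector products these relations are solved by the two
families of the theorem, according to whether \<open>h1\<close> has a non-zero real part
(\<open>quaternion_solutions\<close>).
\<close>

section \<open>Quaternionic equations and vector products\<close>

lemma collinear_if_cross_zero:
  fixes v x :: "real ^ 3"
  assumes "v \<noteq> 0" "cross3 v x = 0"
  shows "x = ((v \<bullet> x) / (v \<bullet> v)) *\<^sub>R v"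
proof -
  have "(v \<bullet> v) *\<^sub>R x = (v \<bullet> x) *\<^sub>R v"
    using Lagrange[of v v x] assms(2) by simp
  then have "(1 / (v \<bullet> v)) *\<^sub>R ((v \<bullet> v) *\<^sub>R x) = (1 / (v \<bullet> v)) *\<^sub>R ((v \<bullet> x) *\<^sub>R v)"
    by simp
  then show ?thesis
    using assms(1) by simp
qed

text \<open>Any non-zero value of \<open>F\<close> spans the whole range, by the previous lemma.  In this way vanishing vector
products express that a map into the imaginary quaternions has rank at most one.\<close>

lemma dim_range_le_1_if_cross_zero:
  fixes F :: "'e \<Rightarrow> real ^ 3"
  assumes "\<And>e f. cross3 (F e) (F f) = 0"
  shows "dim (range F) \<le> 1"
proof (cases "\<exists>e. F e \<noteq> 0")
  case True
  then obtain e where e: "F e \<noteq> 0" by blast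
  have "F f \<in> span {F e}" for f
    using collinear_if_cross_zero[OF e assms] by (metis span_base span_scale singletonI)
  then have "range F \<subseteq> span {F e}" by blast
  then have "dim (range F) \<le> card {F e}"
    by (intro dim_le_card) auto
  then show ?thesis by simp
next
  case False
  then have "dim (range F) = 0" by (subst dim_eq_0) auto
  then show ?thesis by linarith
qed

text \<open>A vector orthogonal to two given ones anticommutes with both in the Clifford algebra, hence
commutes with their product.\<close>

lemma exists_nonzero_orthogonal:
  fixes u v :: "'a::euclidean_space"
  assumes "3 \<le> DIM('a)"
  obtains w where "w \<noteq> 0" "u \<bullet> w = 0" "v \<bullet> w = 0"
proof -
  have "dim {u, v} \<le> card {u, v}" by (intro dim_le_card') simp
  also have "\<dots> \<le> 2" by (simp add: card_insert_if)
  finally have "dim {u, v} < DIM('a)" using assms by simp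
  from orthogonal_to_subspace_exists[OF this] obtain w
    where "w \<noteq> 0" "\<And>y. y \<in> span {u, v} \<Longrightarrow> orthogonal w y" by blast
  then show thesis
    using that[of w] by (simp add: orthogonal_def inner_commute span_base)
qed

text \<open>With h1 = r + v, h3 = s + x and h4 = t + y, the relation
[h1, h3] + \<epsilon> {h1, h4} = 0 has real part r t = v \<bullet> y and imaginary part
v \<times> x + \<epsilon> (r y + t v) = 0.  Pairing the latter with v gives
t (r^2 + |v|^2) = 0, so that t = 0, and the rest follows.\<close>

lemma quaternion_relation_components:
  fixes h1 h3 h4 :: quat and \<epsilon> :: real
  assumes "h1 \<noteq> 0" "\<epsilon> * \<epsilon> = 1"
    and rel: "quat_mult h1 h3 - quat_mult h3 h1 + \<epsilon> *\<^sub>R (quat_mult h1 h4 + quat_mult h4 h1) = 0"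
  shows "quat_Re h4 = 0" "quat_Im h1 \<bullet> quat_Im h4 = 0"
    "cross3 (quat_Im h1) (quat_Im h3) = - (\<epsilon> * quat_Re h1) *\<^sub>R quat_Im h4"
proof -
  obtain r v where h1: "h1 = (r, v)" by force
  obtain s x where h3: "h3 = (s, x)" by force
  obtain t y where h4: "h4 = (t, y)" by force
  have \<epsilon>: "\<epsilon> \<noteq> 0" using assms(2) by auto
  have "\<epsilon> * (2 * (r * t - v \<bullet> y)) = 0"
    using arg_cong[OF rel, of fst]
    by (simp add: h1 h3 h4 quat_mult_def inner_commute algebra_simps)
  then have re: "r * t = v \<bullet> y" using \<epsilon> by simp
  have "2 *\<^sub>R (cross3 v x + \<epsilon> *\<^sub>R (r *\<^sub>R y + t *\<^sub>R v)) = 0"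
    using arg_cong[OF rel, of snd]
    by (simp add: h1 h3 h4 quat_mult_def vec_eq_iff forall_3 cross3_def algebra_simps)
  then have im: "cross3 v x + \<epsilon> *\<^sub>R (r *\<^sub>R y + t *\<^sub>R v) = 0" by simp
  \<comment> \<open>pair with \<open>v\<close>, to which the vector product is orthogonal\<close>
  have "\<epsilon> * (r * (v \<bullet> y) + t * (v \<bullet> v)) = 0"
    using arg_cong[OF im, of "\<lambda>z. v \<bullet> z"]
    by (simp add: inner_add_right dot_cross_self)
  then have "\<epsilon> * (t * (r * r + v \<bullet> v)) = 0"
    by (simp add: re[symmetric] algebra_simps)
  then have "t * (r * r + v \<bullet> v) = 0"
    using \<epsilon> by simp
  moreover have "r * r + v \<bullet> v \<noteq> 0"
    using assms(1)  by (auto simp: h1 zero_prod_def add_nonneg_eq_0_iff)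
  ultimately have t: "t = 0" by simp
  then show "quat_Re h4 = 0" "quat_Im h1 \<bullet> quat_Im h4 = 0"
    using re by (simp_all add: h1 h4)
  show "cross3 (quat_Im h1) (quat_Im h3) = - (\<epsilon> * quat_Re h1) *\<^sub>R quat_Im h4"
    using im by (simp add: h1 h3 h4 t eq_neg_iff_add_eq_0)
qed

lemma quat_commutator_Im:
  "quat_mult x y - quat_mult y x = (0, 2 *\<^sub>R cross3 (quat_Im x) (quat_Im y))"
  using cross_skew[of "quat_Im y" "quat_Im x"]
  by (simp add: quat_mult_def inner_commute scaleR_2)

text \<open>The two alternatives of the classification arise here.  Write \<open>r + v\<close> for \<open>h1\<close>, and \<open>x\<close>, \<open>y\<close> for the
imaginary parts of \<open>h3\<close>, \<open>h4\<close>.  The relation of each value with \<open>h1\<close> says that \<open>h4\<close> is imaginary,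
that \<open>y\<close> is orthogonal to \<open>v\<close>, and that \<open>v \<times> x = - \<epsilon> r y\<close>; the two commutator relations say that
\<open>x \<times> x' + y \<times> y' = 0\<close> and \<open>x \<times> y' + y \<times> x' = 0\<close>.

If \<open>r \<noteq> 0\<close>, then \<open>y\<close> is determined by \<open>x\<close> and \<open>y \<times> y'\<close> is a non-negative multiple of
\<open>(v \<bullet> (x \<times> x')) v\<close>, so that \<open>x \<times> x'\<close> can only vanish: \<open>x\<close> has rank at most one.

If \<open>r = 0\<close>, then \<open>x\<close> is parallel to \<open>v\<close>, whence \<open>y \<times> y' = 0\<close> and \<open>y\<close> stays on a line orthogonal to \<open>v\<close>.
The mixed relation says that the two real functionals describing \<open>x\<close> and \<open>y\<close> are proportional,
hence have the same kernel if neither is zero.\<close>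

lemma quaternion_solutions:
  fixes h1 :: quat and h3 h4 :: "'e::euclidean_space \<Rightarrow> quat" and \<epsilon> :: real
  assumes "h1 \<noteq> 0" and \<epsilon>: "\<epsilon> * \<epsilon> = 1" and lin: "linear h3" "linear h4"
    and rel: "\<And>e. quat_mult h1 (h3 e) - quat_mult (h3 e) h1
        + \<epsilon> *\<^sub>R (quat_mult h1 (h4 e) + quat_mult (h4 e) h1) = 0"
    and comm: "\<And>e f. (quat_mult (h3 e) (h3 f) - quat_mult (h3 f) (h3 e))
        + (quat_mult (h4 e) (h4 f) - quat_mult (h4 f) (h4 e)) = 0"
    and mixed: "\<And>e f. (quat_mult (h3 e) (h4 f) - quat_mult (h4 f) (h3 e))
        + (quat_mult (h4 e) (h3 f) - quat_mult (h3 f) (h4 e)) = 0"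
  shows "(quat_Re h1 \<noteq> 0 \<and>
      linear h3 \<and> dim (range (\<lambda>e. quat_Im (h3 e))) \<le> 1 \<and>
      (\<forall>e. h4 e = (0, (- \<epsilon> / quat_Re h1) *\<^sub>R cross3 (quat_Im h1) (quat_Im (h3 e)))))
     \<or>
     (quat_Re h1 = 0 \<and> quat_Im h1 \<noteq> 0 \<and>
      (\<exists>(h3R :: 'e \<Rightarrow> real) (h3C :: 'e \<Rightarrow> real) (h4R :: 'e \<Rightarrow> real) (w :: real ^ 3).
        linear h3R \<and> linear h3C \<and>
        (\<forall>e. h3 e = (h3R e, h3C e *\<^sub>R (quat_Im h1 /\<^sub>R norm (quat_Im h1)))) \<and>
        linear h4R \<and> w \<noteq> 0 \<and> w \<bullet> quat_Im h1 = 0 \<and>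
        (\<forall>e. h4 e = (0, h4R e *\<^sub>R w)) \<and>
        ((\<exists>e. h3C e \<noteq> 0) \<and> (\<exists>e. h4R e \<noteq> 0) \<longrightarrow> {e. h4R e = 0} = {e. h3C e = 0})))"
proof -
  define r v x y where "r = quat_Re h1" and "v = quat_Im h1"
    and "x = (\<lambda>e. quat_Im (h3 e))" and "y = (\<lambda>e. quat_Im (h4 e))"
  have Re_h4: "quat_Re (h4 e) = 0" and vy: "v \<bullet> y e = 0"
    and vx: "cross3 v (x e) = - (\<epsilon> * r) *\<^sub>R y e" for e
    unfolding r_def v_def x_def y_def
    using quaternion_relation_components[OF assms(1,2) rel] by blast+
  have xxyy: "cross3 (x e) (x f) + cross3 (y e) (y f) = 0" for e f
    using comm[of e f] unfolding quat_commutator_Im x_def y_def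
    by (simp add: zero_prod_def flip: scaleR_add_right)
  have xyyx: "cross3 (x e) (y f) + cross3 (y e) (x f) = 0" for e f
    using mixed[of e f] unfolding quat_commutator_Im x_def y_def
    by (simp add: zero_prod_def flip: scaleR_add_right)
  have lin_x: "linear x" and lin_y: "linear y"
    unfolding x_def y_def using lin
    by (auto intro!: linearI simp: linear_add linear_scale)
  show ?thesis
  proof (cases "r = 0")
    case False
    have y: "y e = (- \<epsilon> / r) *\<^sub>R cross3 v (x e)" for e
      using False \<epsilon> by (simp add: vx)
    have xx: "cross3 (x e) (x f) = 0" for e f
    proof -
      \<comment> \<open>\<open>y \<times> y'\<close> is a non-negative multiple of \<open>d v\<close>, so that \<open>x \<times> x'\<close> is a non-positive one;
        but the inner product of \<open>x \<times> x'\<close> with \<open>v\<close> is \<open>d\<close>\<close>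
      define c where "c = \<epsilon> / r"
      define d where "d = cross3 v (x e) \<bullet> x f"
      have "cross3 (y e) (y f) = (c * c * d) *\<^sub>R v"
        using Lagrange[of "cross3 v (x e)" v "x f"]
        by (simp add: y c_def d_def cross_mult_left cross_mult_right dot_cross_self)
      then have eq: "cross3 (x e) (x f) = - (c * c * d) *\<^sub>R v"
        using xxyy[of e f] by (simp add: eq_neg_iff_add_eq_0)
      have "d = v \<bullet> cross3 (x e) (x f)"
        by (metis cross_triple d_def inner_commute)
      then have "d * (1 + c * c * (v \<bullet> v)) = 0"
        by (simp add: eq algebra_simps)
      moreover have "1 + c * c * (v \<bullet> v) > 0"
        by (simp add: add_pos_nonneg)
      ultimately have "d = 0" by simp
      then show ?thesis using eq by simp
    qed
    have "h4 e = (0, y e)" for e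
      by (simp add: prod_eq_iff Re_h4 y_def)
    then show ?thesis
      using False dim_range_le_1_if_cross_zero[of x, OF xx] lin(1) y
      by (auto simp: r_def v_def x_def)
  next
    case True
    then have v: "v \<noteq> 0"
      using assms(1) by (auto simp: r_def v_def prod_eq_iff)
    have vx0: "cross3 v (x e) = 0" for e
      using vx[of e] True by simp
    define h3C where "h3C = (\<lambda>e. (v \<bullet> x e) / norm v)"
    have x: "x e = h3C e *\<^sub>R (v /\<^sub>R norm v)" for e
      using collinear_if_cross_zero[OF v vx0, of e] v
      by (simp add: h3C_def divide_inverse mult.assoc power2_norm_eq_inner[symmetric] power2_eq_square)
    have lin_C: "linear h3C"
      unfolding h3C_def using lin_x
      by (auto intro!: linearI simp: linear_add linear_scale inner_add_right add_divide_distrib)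
    have yy: "cross3 (y e) (y f) = 0" for e f
      using xxyy[of e f] by (simp add: x cross_mult_left cross_mult_right)
    obtain w where w: "w \<noteq> 0" "w \<bullet> v = 0" and yw: "\<And>e. y e = ((w \<bullet> y e) / (w \<bullet> w)) *\<^sub>R w"
      \<comment> \<open>if \<open>y\<close> vanishes identically, every line orthogonal to \<open>v\<close> serves\<close>
    proof (cases "\<exists>e. y e \<noteq> 0")
      case True
      then obtain e where "y e \<noteq> 0" by blast
      then show thesis
        using that[of "y e"] vy[of e] collinear_if_cross_zero yy by (metis inner_commute)
    next
      case False
      obtain w where "w \<noteq> 0" "v \<bullet> w = 0" "v \<bullet> w = 0"
        using exists_nonzero_orthogonal[of v v] by auto
      then show thesis using that[of w] False by (simp add: inner_commute)
    qed
    define h4R where "h4R = (\<lambda>e. (w \<bullet> y e) / (w \<bullet> w))"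
    have lin_4: "linear h4R"
      unfolding h4R_def using lin_y
      by (auto intro!: linearI simp: linear_add linear_scale inner_add_right add_divide_distrib)
    have y: "y e = h4R e *\<^sub>R w" for e
      using yw by (simp add: h4R_def)
    have vw: "cross3 v w \<noteq> 0"
      using collinear_if_cross_zero[OF v, of w] w by (auto simp: inner_commute)
    have ker: "h3C e * h4R f = h4R e * h3C f" for e f
    proof -
      have "(h3C e * h4R f - h4R e * h3C f) *\<^sub>R (inverse (norm v) *\<^sub>R cross3 v w) = 0"
        using xyyx[of e f] cross_skew[of w v]
        by (simp add: x y cross_mult_left cross_mult_right algebra_simps)
      then show ?thesis using vw v by simp
    qed
    have "\<exists>(h3R :: 'e \<Rightarrow> real) (h3C :: 'e \<Rightarrow> real) (h4R :: 'e \<Rightarrow> real) (w :: real ^ 3).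
        linear h3R \<and> linear h3C \<and>
        (\<forall>e. h3 e = (h3R e, h3C e *\<^sub>R (quat_Im h1 /\<^sub>R norm (quat_Im h1)))) \<and>
        linear h4R \<and> w \<noteq> 0 \<and> w \<bullet> quat_Im h1 = 0 \<and>
        (\<forall>e. h4 e = (0, h4R e *\<^sub>R w)) \<and>
        ((\<exists>e. h3C e \<noteq> 0) \<and> (\<exists>e. h4R e \<noteq> 0) \<longrightarrow> {e. h4R e = 0} = {e. h3C e = 0})"
    proof (intro exI conjI allI impI)
      show "linear (\<lambda>e. quat_Re (h3 e))"
        using lin(1) by (auto intro!: linearI simp: linear_add linear_scale)
      show "h3 e = (quat_Re (h3 e), h3C e *\<^sub>R (quat_Im h1 /\<^sub>R norm (quat_Im h1)))" for e
        using x[of e] by (simp add: x_def v_def prod_eq_iff)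
      show "w \<bullet> quat_Im h1 = 0" using w by (simp add: v_def)
      show "h4 e = (0, h4R e *\<^sub>R w)" for e
        using y[of e] by (simp add: y_def prod_eq_iff Re_h4)
      assume "(\<exists>e. h3C e \<noteq> 0) \<and> (\<exists>e. h4R e \<noteq> 0)"
      then obtain f g where "h3C f \<noteq> 0" "h4R g \<noteq> 0" by blast
      then show "{e. h4R e = 0} = {e. h3C e = 0}"
        using ker by (metis mult_eq_0_iff)
    qed (use lin_C lin_4 w in auto)
    then show ?thesis using True v by (simp add: r_def v_def)
  qed
qed

section \<open>Spinors with quaternionic Schur algebra\<close>

text \<open>The algebra of the spinor module of a Euclidean space of dimension \<open>8 m + 4\<close>: an involution \<open>\<omega>\<close>
which anticommutes with all vectors and commutes with the Schur algebra, and quaternions as Schur algebra.  Operators are compared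
on single spinors, where they are brought to the normal form \<open>\<gamma> u (\<gamma> v (\<omega> (\<iota> q x)))\<close> by moving
Clifford multiplications to the left and quaternions to the right.\<close>

locale quaternionic_spinors =
  fixes \<gamma> :: "'e::euclidean_space \<Rightarrow> ('s::euclidean_space \<Rightarrow>\<^sub>L 's)"
    and \<omega> :: "'s \<Rightarrow>\<^sub>L 's"
    and \<iota> :: "quat \<Rightarrow> ('s \<Rightarrow>\<^sub>L 's)"
  assumes \<gamma>_linear: "linear \<gamma>"
    and \<gamma>_square: "\<gamma> v (\<gamma> v x) = (v \<bullet> v) *\<^sub>R x"
    and \<omega>_square: "\<omega> (\<omega> x) = x"
    and \<omega>_\<gamma>: "\<omega> (\<gamma> v x) = - \<gamma> v (\<omega> x)"
    and \<omega>_schur: "T \<in> schur_algebra \<gamma> \<Longrightarrow> T (\<omega> x) = \<omega> (T x)"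
    and \<iota>: "quat_identification \<iota> (schur_algebra \<gamma>)"
    and dim_ge_3: "3 \<le> DIM('e)"
begin

lemma schur_iff: "T \<in> schur_algebra \<gamma> \<longleftrightarrow> (\<forall>v x. T (\<gamma> v x) = \<gamma> v (T x))"
  unfolding schur_algebra_def by (auto simp: fun_eq_iff simp flip: blinfun_apply_inject)

lemma \<iota>_linear: "linear \<iota>"
  and \<iota>_mult: "\<iota> (quat_mult p q) x = \<iota> p (\<iota> q x)"
  and \<iota>_one: "\<iota> (1, 0) x = x"
  and \<iota>_schur: "\<iota> p \<in> schur_algebra \<gamma>"
proof -
  show "\<iota> (quat_mult p q) x = \<iota> p (\<iota> q x)"
    using \<iota> unfolding quat_identification_def by (metis blinfun_apply_blinfun_compose)
qed (use \<iota> in \<open>auto simp: quat_identification_def bij_betw_def\<close>)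

lemma \<iota>_surj: "T \<in> schur_algebra \<gamma> \<Longrightarrow> \<exists>p. T = \<iota> p"
  using \<iota> unfolding quat_identification_def bij_betw_def by blast

lemma \<iota>_add: "\<iota> (p + q) x = \<iota> p x + \<iota> q x"
  and \<iota>_diff: "\<iota> (p - q) x = \<iota> p x - \<iota> q x"
  and \<iota>_minus: "\<iota> (- p) x = - \<iota> p x"
  and \<iota>_scale: "\<iota> (c *\<^sub>R p) x = c *\<^sub>R \<iota> p x"
  using \<iota>_linear
  by (simp_all add: linear_add linear_diff linear_neg linear_scale blinfun.bilinear_simps)

lemma \<iota>_\<gamma>: "\<iota> p (\<gamma> v x) = \<gamma> v (\<iota> p x)"
  using \<iota>_schur schur_iff by blast

lemma \<iota>_\<omega>: "\<iota> p (\<omega> x) = \<omega> (\<iota> p x)"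
  using \<iota>_schur \<omega>_schur by blast

lemma \<iota>_eq_0: "(\<And>x. \<iota> p x = 0) \<Longrightarrow> p = 0"
proof -
  assume "\<And>x. \<iota> p x = 0"
  then have "\<iota> p = \<iota> 0"
    by (intro blinfun_eqI) (simp add: linear_0[OF \<iota>_linear])
  then show "p = 0"
    using \<iota> unfolding quat_identification_def bij_betw_def by (metis injD)
qed

lemma \<gamma>_add: "\<gamma> (u + v) x = \<gamma> u x + \<gamma> v x"
  and \<gamma>_scale: "\<gamma> (c *\<^sub>R u) x = c *\<^sub>R \<gamma> u x"
  using \<gamma>_linear
  by (simp_all add: linear_add linear_scale blinfun.bilinear_simps)

lemma clifford_relation: "\<gamma> u (\<gamma> v x) + \<gamma> v (\<gamma> u x) = (2 * (u \<bullet> v)) *\<^sub>R x"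
proof -
  have "\<gamma> (u + v) (\<gamma> (u + v) x) = (u \<bullet> u + 2 * (u \<bullet> v) + v \<bullet> v) *\<^sub>R x"
    by (simp add: \<gamma>_square inner_add_left inner_add_right inner_commute)
  then show ?thesis
    by (simp add: \<gamma>_add \<gamma>_square blinfun.add_left blinfun.add_right scaleR_add_left
        add.commute)
qed

lemma \<gamma>_orthogonal: "u \<bullet> v = 0 \<Longrightarrow> \<gamma> u (\<gamma> v x) = - \<gamma> v (\<gamma> u x)"
  using clifford_relation[of u v x] by (simp add: eq_neg_iff_add_eq_0)

lemma \<gamma>_cancel:
  assumes "v \<noteq> 0" "\<gamma> v x = 0" shows "x = 0"
  using \<gamma>_square[of v x] assms by (simp add: blinfun.bilinear_simps)

text \<open>Associativity comes for free from the faithful action on spinors, so that multiplication by the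
conjugate of \<open>p\<close> from the left yields \<open>|p|\<^sup>2 q = 0\<close>.\<close>

lemma quat_no_zero_divisors:
  assumes "quat_mult p q = 0" "p \<noteq> 0" shows "q = 0"
proof -
  have "quat_mult (quat_Re p, - quat_Im p) p = (p \<bullet> p) *\<^sub>R (1, 0)"
    by (simp add: quat_mult_def inner_prod_def)
  then have "(p \<bullet> p) *\<^sub>R \<iota> q x = \<iota> (quat_Re p, - quat_Im p) (\<iota> p (\<iota> q x))" for x
    by (metis \<iota>_mult \<iota>_one \<iota>_scale)
  then have "(p \<bullet> p) *\<^sub>R \<iota> q x = 0" for x
    using assms(1) by (simp add: \<iota>_mult[symmetric] linear_0[OF \<iota>_linear] blinfun.bilinear_simps)
  then show ?thesis using \<open>p \<noteq> 0\<close> by (intro \<iota>_eq_0) simp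
qed

text \<open>The operators \<open>1\<close>, \<open>f\<close>, \<open>\<omega>\<close>, \<open>f \<omega>\<close> are linearly independent over the quaternions: conjugation by
\<open>f\<close> and by a vector \<open>e\<close> orthogonal to \<open>f\<close> acts on them by four different pairs of signs.\<close>

lemma coefficients_unique:
  assumes "f \<noteq> 0"
    and zero: "\<And>x. \<iota> p x + \<gamma> f (\<iota> q x) + \<omega> (\<iota> r x) + \<gamma> f (\<omega> (\<iota> s x)) = 0"
  shows "p = 0" "q = 0" "r = 0" "s = 0"
proof -
  obtain e where e: "e \<noteq> 0" "f \<bullet> e = 0"
    using exists_nonzero_orthogonal[OF dim_ge_3, of f f] by blast
  have conj_e: "\<iota> p x - \<gamma> f (\<iota> q x) - \<omega> (\<iota> r x) + \<gamma> f (\<omega> (\<iota> s x)) = 0" for x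
  proof -
    have "\<gamma> e (\<iota> p x - \<gamma> f (\<iota> q x) - \<omega> (\<iota> r x) + \<gamma> f (\<omega> (\<iota> s x))) = 0"
      using zero[of "\<gamma> e x"] \<gamma>_orthogonal[OF e(2)]
      by (simp add: blinfun.bilinear_simps \<iota>_\<gamma> \<omega>_\<gamma>)
    then show ?thesis by (rule \<gamma>_cancel[OF e(1)])
  qed
  have conj_f: "\<iota> p x + \<gamma> f (\<iota> q x) - \<omega> (\<iota> r x) - \<gamma> f (\<omega> (\<iota> s x)) = 0" for x
  proof -
    have "\<gamma> f (\<iota> p x + \<gamma> f (\<iota> q x) - \<omega> (\<iota> r x) - \<gamma> f (\<omega> (\<iota> s x))) = 0"
      using zero[of "\<gamma> f x"] by (simp add: blinfun.bilinear_simps \<iota>_\<gamma> \<omega>_\<gamma>)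
    then show ?thesis by (rule \<gamma>_cancel[OF assms(1)])
  qed
  have conj_ef: "\<iota> p x - \<gamma> f (\<iota> q x) + \<omega> (\<iota> r x) - \<gamma> f (\<omega> (\<iota> s x)) = 0" for x
  proof -
    have "\<gamma> e (\<iota> p x - \<gamma> f (\<iota> q x) + \<omega> (\<iota> r x) - \<gamma> f (\<omega> (\<iota> s x))) = 0"
      using conj_f[of "\<gamma> e x"] \<gamma>_orthogonal[OF e(2)]
      by (simp add: blinfun.bilinear_simps \<iota>_\<gamma> \<omega>_\<gamma>)
    then show ?thesis by (rule \<gamma>_cancel[OF e(1)])
  qed
  have four: "a = 0 \<and> b = 0 \<and> c = 0 \<and> d = 0"
    if "a + b + c + d = 0" "a - b - c + d = 0" "a + b - c - d = 0" "a - b + c - d = 0"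
    for a b c d :: 's
  proof -
    have "4 *\<^sub>R a = (a + b + c + d) + (a - b - c + d) + (a + b - c - d) + (a - b + c - d)"
      "4 *\<^sub>R b = (a + b + c + d) - (a - b - c + d) + (a + b - c - d) - (a - b + c - d)"
      "4 *\<^sub>R c = (a + b + c + d) - (a - b - c + d) - (a + b - c - d) + (a - b + c - d)"
      "4 *\<^sub>R d = (a + b + c + d) + (a - b - c + d) - (a + b - c - d) - (a - b + c - d)"
      by (simp_all add: scaleR_add_left[of 2 2, simplified] scaleR_2)
    from this[unfolded that] show ?thesis by simp
  qed
  have parts: "\<iota> p x = 0" "\<gamma> f (\<iota> q x) = 0" "\<omega> (\<iota> r x) = 0" "\<gamma> f (\<omega> (\<iota> s x)) = 0" for x
    using four[OF zero[of x] conj_e[of x] conj_f[of x] conj_ef[of x]] by blast+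
  have \<omega>_cancel: "y = 0" if "\<omega> y = 0" for y
    using \<omega>_square[of y] that by (simp add: blinfun.bilinear_simps)
  show "p = 0" "q = 0" "r = 0" "s = 0"
    using parts \<gamma>_cancel[OF assms(1)] \<omega>_cancel by (blast intro: \<iota>_eq_0)+
qed

lemma coefficients_unique_2:
  assumes "\<And>x. \<iota> p x + \<omega> (\<iota> r x) = 0"
  shows "p = 0" "r = 0"
proof -
  obtain f :: 'e where "f \<noteq> 0" using exists_nonzero_orthogonal[OF dim_ge_3] by blast
  then show "p = 0" "r = 0"
    using assms coefficients_unique[of f p 0 r 0]
    by (simp_all add: linear_0[OF \<iota>_linear] blinfun.bilinear_simps)
qed

text \<open>Conjugation of \<open>T\<close> by a unit vector \<open>n\<close> does not depend on \<open>n\<close>, since \<open>T\<close> commutes with products of two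
vectors, and it is an involution.  Its eigenspaces consist of the operators commuting
with all vectors, which are quaternions, and of those anticommuting with all vectors, which become
quaternions after multiplication by \<open>\<omega>\<close>.\<close>

lemma even_commutant:
  fixes T :: "'s \<Rightarrow>\<^sub>L 's"
  assumes even: "\<And>u v x. T (\<gamma> u (\<gamma> v x)) = \<gamma> u (\<gamma> v (T x))"
  shows "\<exists>h k. \<forall>x. blinfun_apply T x = \<iota> h x + \<omega> (\<iota> k x)"
proof -
  obtain n :: 'e where n: "norm n = 1"
    using vector_choose_size[OF zero_le_one] by blast
  then have nn: "\<gamma> n (\<gamma> n x) = x" for x
    by (simp add: \<gamma>_square norm_eq_1)
  have conj: "\<gamma> v (\<gamma> n (T (\<gamma> n x))) = T (\<gamma> v x)" for v x
    using even[of v n "\<gamma> n x"] by (simp add: nn)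
  have conj': "\<gamma> n (T (\<gamma> n (\<gamma> v x))) = \<gamma> v (T x)" for v x
    by (simp add: even nn)
  have \<gamma>_\<omega>: "\<gamma> v (\<omega> x) = - \<omega> (\<gamma> v x)" for v x
    by (simp add: \<omega>_\<gamma>)
  \<comment> \<open>the invariant part, and \<open>\<omega>\<close> times the anti-invariant part, of \<open>T\<close> under conjugation\<close>
  define T1 where "T1 = (1 / 2) *\<^sub>R (T + (\<gamma> n o\<^sub>L T o\<^sub>L \<gamma> n))"
  define T2 where "T2 = (1 / 2) *\<^sub>R (\<omega> o\<^sub>L (T - (\<gamma> n o\<^sub>L T o\<^sub>L \<gamma> n)))"
  have "T1 \<in> schur_algebra \<gamma>"
    unfolding schur_iff T1_def by (simp add: blinfun.bilinear_simps conj conj' add.commute)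
  moreover have "T2 \<in> schur_algebra \<gamma>"
    unfolding schur_iff T2_def by (simp add: blinfun.bilinear_simps conj conj' \<gamma>_\<omega>)
  ultimately obtain h k where "T1 = \<iota> h" "T2 = \<iota> k"
    using \<iota>_surj by blast
  moreover have "T x = T1 x + \<omega> (T2 x)" for x
    by (simp add: T1_def T2_def blinfun.bilinear_simps \<omega>_square scaleR_diff_right scaleR_add_right
        flip: scaleR_add_left)
  ultimately show ?thesis by metis
qed

text \<open>For commuting elements the difference of squares factors.\<close>

lemma quat_commuting_square_roots:
  assumes "quat_mult h k = quat_mult k h" "quat_mult h h = quat_mult k k"
  shows "k = h \<or> k = - h"
proof -
  have "quat_mult (h - k) (h + k) = 0"
  proof (rule \<iota>_eq_0)
    fix x
    show "\<iota> (quat_mult (h - k) (h + k)) x = 0"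
      using arg_cong[OF assms(1), of "\<lambda>p. \<iota> p x"] arg_cong[OF assms(2), of "\<lambda>p. \<iota> p x"]
      by (simp add: \<iota>_mult \<iota>_add \<iota>_diff blinfun.bilinear_simps)
  qed
  then have "h - k = 0 \<or> h + k = 0"
    using quat_no_zero_divisors by blast
  then show ?thesis by (auto simp: eq_neg_iff_add_eq_0 add.commute)
qed

text \<open>Multiplication of the difference of both sides by \<open>u\<close> gives \<open>a u u - u u a\<close>, and \<open>u u\<close> is a scalar.\<close>

lemma intertwiner_swap:
  fixes a g :: "'s \<Rightarrow>\<^sub>L 's"
  assumes "\<And>x. \<gamma> u (g x) = a (\<gamma> u x)"
  shows "g (\<gamma> u x) = \<gamma> u (a x)"
proof (cases "u = 0")
  case True
  then show ?thesis by (simp add: linear_0[OF \<gamma>_linear] blinfun.bilinear_simps)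
next
  case False
  have "\<gamma> u (g (\<gamma> u x) - \<gamma> u (a x)) = 0"
    by (simp add: blinfun.bilinear_simps assms \<gamma>_square)
  then show ?thesis using \<gamma>_cancel[OF False] by (metis eq_iff_diff_eq_0)
qed

text \<open>The block \<open>a\<close> commutes with products of two vectors, because \<open>a u v = u g v = u v a\<close>; and \<open>g\<close> is the
conjugate of \<open>a\<close> by a unit vector, which reverses the sign of the part containing \<open>\<omega>\<close>.\<close>

lemma intertwiner_form:
  fixes a g :: "'s \<Rightarrow>\<^sub>L 's"
  assumes "\<And>u x. \<gamma> u (g x) = a (\<gamma> u x)"
  shows "\<exists>p q. (\<forall>x. a x = \<iota> p x - \<omega> (\<iota> q x)) \<and> (\<forall>x. g x = \<iota> p x + \<omega> (\<iota> q x))"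
proof -
  note swap = intertwiner_swap[of _ g a, OF assms]
  have "a (\<gamma> u (\<gamma> v x)) = \<gamma> u (\<gamma> v (a x))" for u v x
    by (simp add: swap flip: assms)
  then obtain p q where a: "\<And>x. a x = \<iota> p x + \<omega> (\<iota> q x)"
    using even_commutant by metis
  obtain n :: 'e where "norm n = 1"
    using vector_choose_size[OF zero_le_one] by blast
  then have nn: "\<gamma> n (\<gamma> n x) = x" for x
    by (simp add: \<gamma>_square norm_eq_1)
  have "g x = \<gamma> n (a (\<gamma> n x))" for x
    using swap[of n "\<gamma> n x"] by (simp add: nn)
  then have "g x = \<iota> p x - \<omega> (\<iota> q x)" for x
    by (simp add: a \<iota>_\<gamma> \<omega>_\<gamma> blinfun.bilinear_simps nn)
  then show ?thesis
    using a by (intro exI[of _ p] exI[of _ "- q"]) (simp add: \<iota>_minus blinfun.bilinear_simps)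
qed

text \<open>Choose \<open>f\<close> orthogonal to \<open>u\<close> and \<open>v\<close>.  Then \<open>u\<close> and \<open>v\<close> intertwine \<open>a f\<close> and \<open>g f\<close>, so that \<open>u v\<close>
commutes with both of them; it also commutes with \<open>f\<close>.  Hence it commutes with \<open>f g(f) - a(f) f\<close>, which
is a non-zero multiple of \<open>H\<close>.\<close>

lemma charge_even:
  fixes a g :: "'e \<Rightarrow> ('s \<Rightarrow>\<^sub>L 's)"
  assumes mixed: "\<And>e f x. \<gamma> e (g f x) - a f (\<gamma> e x) = (e \<bullet> f) *\<^sub>R H x"
  shows "H (\<gamma> u (\<gamma> v x)) = \<gamma> u (\<gamma> v (H x))"
proof -
  obtain f where f: "f \<noteq> 0" "u \<bullet> f = 0" "v \<bullet> f = 0"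
    using exists_nonzero_orthogonal[OF dim_ge_3] by blast
  have swap: "\<gamma> w (g f y) = a f (\<gamma> w y)" if "w \<bullet> f = 0" for w y
    using mixed[of w f y] that by simp
  have swap': "g f (\<gamma> w y) = \<gamma> w (a f y)" if "w \<bullet> f = 0" for w y
    by (rule intertwiner_swap) (rule swap[OF that])
  have g: "g f (\<gamma> u (\<gamma> v y)) = \<gamma> u (\<gamma> v (g f y))"
    and a: "a f (\<gamma> u (\<gamma> v y)) = \<gamma> u (\<gamma> v (a f y))" for y
    by (simp_all add: swap' f flip: swap)
  have f_uv: "\<gamma> f (\<gamma> u (\<gamma> v y)) = \<gamma> u (\<gamma> v (\<gamma> f y))" for y
    using f \<gamma>_orthogonal[of f] by (simp add: inner_commute blinfun.bilinear_simps)
  have "(f \<bullet> f) *\<^sub>R H (\<gamma> u (\<gamma> v x)) = (f \<bullet> f) *\<^sub>R \<gamma> u (\<gamma> v (H x))"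
    by (simp flip: blinfun.scaleR_right mixed add: f_uv g a) (simp add: blinfun.bilinear_simps)
  then show ?thesis using f by simp
qed

text \<open>The terms in \<open>h\<close> and \<open>k\<close> form a particular solution of the inhomogeneous linear equation
\<open>e g(f) - a(f) e = (e \<bullet> f) H\<close>.  The difference of two solutions intertwines every vector.\<close>

lemma diagonal_block_form:
  fixes a g :: "'e \<Rightarrow> ('s \<Rightarrow>\<^sub>L 's)" and H :: "'s \<Rightarrow>\<^sub>L 's"
  assumes mixed: "\<And>e f x. \<gamma> e (g f x) - a f (\<gamma> e x) = (e \<bullet> f) *\<^sub>R H x"
    and H: "\<And>x. H x = \<iota> h x + \<omega> (\<iota> k x)"
  shows "\<exists>p q. \<forall>x.
    2 *\<^sub>R a f x = \<iota> p x - \<gamma> f (\<iota> h x) + \<gamma> f (\<omega> (\<iota> k x)) - \<omega> (\<iota> q x) \<and>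
    2 *\<^sub>R g f x = \<iota> p x + \<gamma> f (\<iota> h x) + \<gamma> f (\<omega> (\<iota> k x)) + \<omega> (\<iota> q x)"
proof -
  define a' where "a' = 2 *\<^sub>R a f + (\<gamma> f o\<^sub>L \<iota> h) - (\<gamma> f o\<^sub>L \<omega> o\<^sub>L \<iota> k)"
  define g' where "g' = 2 *\<^sub>R g f - (\<gamma> f o\<^sub>L \<iota> h) - (\<gamma> f o\<^sub>L \<omega> o\<^sub>L \<iota> k)"
  have "\<gamma> u (g' x) - a' (\<gamma> u x) = 0" for u x
  proof -
    have "\<gamma> u (g' x) - a' (\<gamma> u x) = 2 *\<^sub>R (\<gamma> u (g f x) - a f (\<gamma> u x))
      - (\<gamma> u (\<gamma> f (\<iota> h x)) + \<gamma> f (\<gamma> u (\<iota> h x)))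
      - (\<gamma> u (\<gamma> f (\<omega> (\<iota> k x))) + \<gamma> f (\<gamma> u (\<omega> (\<iota> k x))))"
      by (simp add: a'_def g'_def blinfun.bilinear_simps \<iota>_\<gamma> \<omega>_\<gamma> scaleR_diff_right)
    also have "\<dots> = 0"
      unfolding mixed H clifford_relation by (simp add: algebra_simps)
    finally show ?thesis .
  qed
  then have "\<gamma> u (g' x) = a' (\<gamma> u x)" for u x by simp
  from intertwiner_form[OF this] obtain p q
    where pq: "\<And>x. a' x = \<iota> p x - \<omega> (\<iota> q x)" "\<And>x. g' x = \<iota> p x + \<omega> (\<iota> q x)" by blast
  show ?thesis
  proof (intro exI allI conjI)
    fix x
    show "2 *\<^sub>R a f x = \<iota> p x - \<gamma> f (\<iota> h x) + \<gamma> f (\<omega> (\<iota> k x)) - \<omega> (\<iota> q x)"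
      using pq(1)[of x] by (simp add: a'_def blinfun.bilinear_simps algebra_simps)
    show "2 *\<^sub>R g f x = \<iota> p x + \<gamma> f (\<iota> h x) + \<gamma> f (\<omega> (\<iota> k x)) + \<omega> (\<iota> q x)"
      using pq(2)[of x] by (simp add: g'_def blinfun.bilinear_simps algebra_simps)
  qed
qed

text \<open>Expanding \<open>H g = a H\<close> in terms of \<open>1\<close>, \<open>f\<close>, \<open>\<omega>\<close>, \<open>f \<omega>\<close> and comparing coefficients.\<close>

lemma charge_commutation:
  fixes a g H :: "'s \<Rightarrow>\<^sub>L 's"
  assumes H: "\<And>x. H x = \<iota> h x + \<omega> (\<iota> k x)"
    and a: "\<And>x. 2 *\<^sub>R a x = \<iota> p x - \<gamma> f (\<iota> h x) + \<gamma> f (\<omega> (\<iota> k x)) - \<omega> (\<iota> q x)"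
    and g: "\<And>x. 2 *\<^sub>R g x = \<iota> p x + \<gamma> f (\<iota> h x) + \<gamma> f (\<omega> (\<iota> k x)) + \<omega> (\<iota> q x)"
    and comm: "\<And>x. H (g x) = a (H x)" and "f \<noteq> 0"
  shows "quat_mult h p - quat_mult p h + (quat_mult k q + quat_mult q k) = 0"
    and "quat_mult h h = quat_mult k k" "quat_mult h k = quat_mult k h"
proof -
  have eq: "\<iota> (quat_mult h p - quat_mult p h + (quat_mult k q + quat_mult q k)) x
      + \<gamma> f (\<iota> (2 *\<^sub>R (quat_mult h h - quat_mult k k)) x)
      + \<omega> (\<iota> (quat_mult h q + quat_mult q h + (quat_mult k p - quat_mult p k)) x)
      + \<gamma> f (\<omega> (\<iota> (2 *\<^sub>R (quat_mult h k - quat_mult k h)) x)) = 0" (is "?L = 0") for x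
  proof -
    have "?L = H (2 *\<^sub>R g x) - 2 *\<^sub>R a (H x)"
      unfolding H a g
      by (simp add: \<iota>_add \<iota>_diff \<iota>_mult \<iota>_scale \<iota>_\<gamma> \<iota>_\<omega> \<omega>_\<gamma> \<omega>_square blinfun.bilinear_simps scaleR_2)
    also have "\<dots> = 0"
      using comm[of x] by (simp add: blinfun.bilinear_simps)
    finally show ?thesis .
  qed
  note zero = coefficients_unique[OF \<open>f \<noteq> 0\<close> eq]
  show "quat_mult h p - quat_mult p h + (quat_mult k q + quat_mult q k) = 0"
    by (rule zero(1))
  show "quat_mult h h = quat_mult k k" "quat_mult h k = quat_mult k h"
    using zero(2,4) by simp_all
qed

text \<open>In the commutator of \<open>a\<close> and \<open>a'\<close> the terms with \<open>e\<close> or \<open>f\<close> cancel because of the relations with \<open>h\<close>,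
and those with \<open>e f\<close> because \<open>\<epsilon>\<^sup>2 = 1\<close>; only the coefficients of \<open>1\<close> and \<open>\<omega>\<close> remain.\<close>

lemma diagonal_commutation:
  fixes a a' :: "'s \<Rightarrow>\<^sub>L 's" and \<epsilon> :: real
  assumes \<epsilon>: "\<epsilon> \<in> {1, - 1}"
    and a: "\<And>x. 2 *\<^sub>R a x = \<iota> p x - \<gamma> e (\<iota> h x) + \<gamma> e (\<omega> (\<iota> (\<epsilon> *\<^sub>R h) x)) - \<omega> (\<iota> q x)"
    and a': "\<And>x. 2 *\<^sub>R a' x = \<iota> p' x - \<gamma> f (\<iota> h x) + \<gamma> f (\<omega> (\<iota> (\<epsilon> *\<^sub>R h) x)) - \<omega> (\<iota> q' x)"
    and rel: "quat_mult h p - quat_mult p h + \<epsilon> *\<^sub>R (quat_mult h q + quat_mult q h) = 0"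
    and rel': "quat_mult h p' - quat_mult p' h + \<epsilon> *\<^sub>R (quat_mult h q' + quat_mult q' h) = 0"
    and comm: "\<And>x. a (a' x) = a' (a x)"
  shows "(quat_mult p p' - quat_mult p' p) + (quat_mult q q' - quat_mult q' q) = 0"
    and "(quat_mult p q' - quat_mult q' p) + (quat_mult q p' - quat_mult p' q) = 0"
proof -
  have r: "\<iota> h (\<iota> p x) = \<iota> p (\<iota> h x) - \<epsilon> *\<^sub>R (\<iota> h (\<iota> q x) + \<iota> q (\<iota> h x))" for x
    using arg_cong[OF rel, of "\<lambda>z. \<iota> z x"]
    by (simp add: \<iota>_add \<iota>_diff \<iota>_mult \<iota>_scale linear_0[OF \<iota>_linear] algebra_simps)
  have r': "\<iota> h (\<iota> p' x) = \<iota> p' (\<iota> h x) - \<epsilon> *\<^sub>R (\<iota> h (\<iota> q' x) + \<iota> q' (\<iota> h x))" for x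
    using arg_cong[OF rel', of "\<lambda>z. \<iota> z x"]
    by (simp add: \<iota>_add \<iota>_diff \<iota>_mult \<iota>_scale linear_0[OF \<iota>_linear] algebra_simps)
  have eq: "\<iota> ((quat_mult p p' - quat_mult p' p) + (quat_mult q q' - quat_mult q' q)) x
      + \<omega> (\<iota> (- ((quat_mult p q' - quat_mult q' p) + (quat_mult q p' - quat_mult p' q))) x) = 0"
    (is "?L = 0") for x
  proof -
    have "?L = 2 *\<^sub>R a (2 *\<^sub>R a' x) - 2 *\<^sub>R a' (2 *\<^sub>R a x)"
      unfolding a a' using \<epsilon>
      by (auto simp: \<iota>_add \<iota>_diff \<iota>_minus \<iota>_mult \<iota>_\<gamma> \<iota>_\<omega> \<omega>_\<gamma> \<omega>_square r r'
          blinfun.bilinear_simps)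
    also have "\<dots> = 0"
      using comm[of x] by (simp add: blinfun.bilinear_simps)
    finally show ?thesis .
  qed
  from coefficients_unique_2[OF eq]
  show "(quat_mult p p' - quat_mult p' p) + (quat_mult q q' - quat_mult q' q) = 0"
    and "(quat_mult p q' - quat_mult q' p) + (quat_mult q p' - quat_mult p' q) = 0"
    by (simp_all add: neg_equal_0_iff_equal del: minus_add_distrib)
qed

text \<open>The quaternionic coefficients \<open>h\<close>, \<open>k\<close> of \<open>H\<close> commute and have the same square, hence \<open>k = \<plusminus>h\<close>.  This is
the origin of the sign \<open>\<epsilon>\<close>, and it makes \<open>1 + \<epsilon> \<omega>\<close> a factor of \<open>H\<close>.\<close>

lemma heisenberg_diagonal_blocks:
  fixes a g :: "'e \<Rightarrow> ('s \<Rightarrow>\<^sub>L 's)" and H :: "'s \<Rightarrow>\<^sub>L 's"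
  assumes lin: "linear a" and "H \<noteq> 0"
    and mixed: "\<And>e f x. \<gamma> e (g f x) - a f (\<gamma> e x) = (e \<bullet> f) *\<^sub>R H x"
    and central: "\<And>f x. H (g f x) = a f (H x)"
    and comm: "\<And>e f x. a e (a f x) = a f (a e x)"
  obtains \<epsilon> :: real and h p q where "\<epsilon> \<in> {1, - 1}" "h \<noteq> 0" "linear p" "linear q"
    "\<And>x. H x = \<iota> h x + \<omega> (\<iota> (\<epsilon> *\<^sub>R h) x)"
    "\<And>f x. 2 *\<^sub>R a f x
      = \<iota> (p f) x - \<gamma> f (\<iota> h x) + \<gamma> f (\<omega> (\<iota> (\<epsilon> *\<^sub>R h) x)) - \<omega> (\<iota> (q f) x)"
    "\<And>f x. 2 *\<^sub>R g f x
      = \<iota> (p f) x + \<gamma> f (\<iota> h x) + \<gamma> f (\<omega> (\<iota> (\<epsilon> *\<^sub>R h) x)) + \<omega> (\<iota> (q f) x)"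
    "\<And>f. quat_mult h (p f) - quat_mult (p f) h
      + \<epsilon> *\<^sub>R (quat_mult h (q f) + quat_mult (q f) h) = 0"
    "\<And>e f. (quat_mult (p e) (p f) - quat_mult (p f) (p e))
      + (quat_mult (q e) (q f) - quat_mult (q f) (q e)) = 0"
    "\<And>e f. (quat_mult (p e) (q f) - quat_mult (q f) (p e))
      + (quat_mult (q e) (p f) - quat_mult (p f) (q e)) = 0"
proof -
  have "\<exists>h k. \<forall>x. H x = \<iota> h x + \<omega> (\<iota> k x)"
    by (rule even_commutant, rule charge_even, rule mixed)
  then obtain h k where H: "\<And>x. H x = \<iota> h x + \<omega> (\<iota> k x)" by blast
  have "\<exists>p q. \<forall>x.
    2 *\<^sub>R a f x = \<iota> p x - \<gamma> f (\<iota> h x) + \<gamma> f (\<omega> (\<iota> k x)) - \<omega> (\<iota> q x) \<and>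
    2 *\<^sub>R g f x = \<iota> p x + \<gamma> f (\<iota> h x) + \<gamma> f (\<omega> (\<iota> k x)) + \<omega> (\<iota> q x)" for f
    by (rule diagonal_block_form[OF mixed H])
  then obtain p q where
    a: "\<And>f x. 2 *\<^sub>R a f x = \<iota> (p f) x - \<gamma> f (\<iota> h x) + \<gamma> f (\<omega> (\<iota> k x)) - \<omega> (\<iota> (q f) x)" and
    g: "\<And>f x. 2 *\<^sub>R g f x = \<iota> (p f) x + \<gamma> f (\<iota> h x) + \<gamma> f (\<omega> (\<iota> k x)) + \<omega> (\<iota> (q f) x)"
    by metis
  \<comment> \<open>the quaternionic coefficients of a linear map are linear because they are unique\<close>
  have add: "p (e + f) - p e - p f = 0" "- (q (e + f) - q e - q f) = 0" for e f
  proof -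
    have "\<iota> (p (e + f) - p e - p f) x + \<omega> (\<iota> (- (q (e + f) - q e - q f)) x) = 0" (is "?L = 0") for x
    proof -
      have "?L = 2 *\<^sub>R a (e + f) x - 2 *\<^sub>R a e x - 2 *\<^sub>R a f x"
        unfolding a by (simp add: \<iota>_diff \<iota>_minus \<iota>_add \<gamma>_add blinfun.bilinear_simps)
      also have "\<dots> = 0"
        by (simp add: linear_add[OF lin] blinfun.bilinear_simps scaleR_add_right)
      finally show ?thesis .
    qed
    from coefficients_unique_2[OF this]
    show "p (e + f) - p e - p f = 0" "- (q (e + f) - q e - q f) = 0" .
  qed
  have scale: "p (c *\<^sub>R f) - c *\<^sub>R p f = 0" "- (q (c *\<^sub>R f) - c *\<^sub>R q f) = 0" for c f
  proof -
    have "\<iota> (p (c *\<^sub>R f) - c *\<^sub>R p f) x + \<omega> (\<iota> (- (q (c *\<^sub>R f) - c *\<^sub>R q f)) x) = 0" (is "?L = 0") for x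
    proof -
      have "?L = 2 *\<^sub>R a (c *\<^sub>R f) x - c *\<^sub>R (2 *\<^sub>R a f x)"
        unfolding a
        by (simp add: \<iota>_diff \<iota>_minus \<iota>_scale \<gamma>_scale blinfun.bilinear_simps algebra_simps)
      also have "\<dots> = 0"
        by (simp add: linear_scale[OF lin] blinfun.bilinear_simps)
      finally show ?thesis .
    qed
    from coefficients_unique_2[OF this]
    show "p (c *\<^sub>R f) - c *\<^sub>R p f = 0" "- (q (c *\<^sub>R f) - c *\<^sub>R q f) = 0" .
  qed
  have linear: "linear p" "linear q"
    using add scale by (auto intro!: linearI simp: algebra_simps)
  have relation: "quat_mult h (p f) - quat_mult (p f) h + (quat_mult k (q f) + quat_mult (q f) k) = 0"
    and squares: "quat_mult h h = quat_mult k k" "quat_mult h k = quat_mult k h" if "f \<noteq> 0" for f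
    using charge_commutation[OF H a g central that] by blast+
  obtain n :: 'e where n: "n \<noteq> 0"
    using exists_nonzero_orthogonal[OF dim_ge_3] by blast
  from quat_commuting_square_roots[OF squares(2,1)[OF n]]
  obtain \<epsilon> :: real where \<epsilon>: "\<epsilon> \<in> {1, - 1}" and k: "k = \<epsilon> *\<^sub>R h"
    by (metis insertCI scaleR_minus_left scaleR_one)
  have "h \<noteq> 0"
  proof
    assume "h = 0"
    then have "H x = 0" for x
      by (simp add: H k linear_0[OF \<iota>_linear] blinfun.bilinear_simps)
    then show False using \<open>H \<noteq> 0\<close> by (auto intro: blinfun_eqI)
  qed
  have quat_mult_scale: "quat_mult (c *\<^sub>R x) y = c *\<^sub>R quat_mult x y"
    "quat_mult x (c *\<^sub>R y) = c *\<^sub>R quat_mult x y" for c x y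
    by (simp_all add: quat_mult_def cross_mult_left cross_mult_right algebra_simps)
  have rel: "quat_mult h (p f) - quat_mult (p f) h
      + \<epsilon> *\<^sub>R (quat_mult h (q f) + quat_mult (q f) h) = 0" for f
  proof (cases "f = 0")
    case True
    then show ?thesis
      using quat_mult_scale(1)[of 0] quat_mult_scale(2)[of _ 0] by (simp add: linear_0 linear)
  next
    case False
    then show ?thesis
      using relation[OF False] by (simp add: k quat_mult_scale scaleR_add_right)
  qed
  note a = a[unfolded k] and g = g[unfolded k] and H = H[unfolded k]
  show thesis
    by (rule that[OF \<epsilon> \<open>h \<noteq> 0\<close> linear H a g rel diagonal_commutation[OF \<epsilon> a a rel rel comm]])
qed

end

section \<open>The volume element\<close>

text \<open>The volume element and a vector can be interchanged at the cost of one sign for each factor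
orthogonal to the vector.  If the vector is itself one of the factors, one sign is lost.\<close>

lemma volume_commute:
  fixes \<gamma> :: "'e::euclidean_space \<Rightarrow> ('s::euclidean_space \<Rightarrow>\<^sub>L 's)"
  assumes anti: "\<And>u v x. u \<bullet> v = 0 \<Longrightarrow> \<gamma> u (\<gamma> v x) = - \<gamma> v (\<gamma> u x)"
    and "\<forall>u \<in> set us. v \<bullet> u = 0"
  shows "volume_action \<gamma> us (\<gamma> v x) = (- 1) ^ length us *\<^sub>R \<gamma> v (volume_action \<gamma> us x)"
  using assms(2)
proof (induction us)
  case (Cons u us)
  then show ?case
    using anti[of u v] by (simp add: volume_action_def blinfun.bilinear_simps inner_commute)
qed (simp add: volume_action_def)

lemma volume_commute_member:
  fixes \<gamma> :: "'e::euclidean_space \<Rightarrow> ('s::euclidean_space \<Rightarrow>\<^sub>L 's)"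
  assumes anti: "\<And>u v x. u \<bullet> v = 0 \<Longrightarrow> \<gamma> u (\<gamma> v x) = - \<gamma> v (\<gamma> u x)"
    and "sorted_wrt (\<lambda>u v. u \<bullet> v = 0) us" "v \<in> set us"
  shows "volume_action \<gamma> us (\<gamma> v x)
    = - ((- 1) ^ length us) *\<^sub>R \<gamma> v (volume_action \<gamma> us x)"
  using assms(2,3)
proof (induction us)
  case (Cons u us)
  show ?case
  proof (cases "v = u")
    case True
    then show ?thesis
      using volume_commute[where \<gamma>=\<gamma>, OF anti, of us u x] Cons.prems
      by (simp add: volume_action_def blinfun.bilinear_simps)
  next
    case False
    then have "u \<bullet> v = 0" "v \<in> set us" using Cons.prems by auto
    then show ?thesis
      using Cons anti[of u v] by (simp add: volume_action_def blinfun.bilinear_simps)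
  qed
qed simp

text \<open>Moving the second copy of each factor next to the first one takes as many transpositions as there
are pairs of factors.\<close>

lemma volume_square:
  fixes \<gamma> :: "'e::euclidean_space \<Rightarrow> ('s::euclidean_space \<Rightarrow>\<^sub>L 's)"
  assumes anti: "\<And>u v x. u \<bullet> v = 0 \<Longrightarrow> \<gamma> u (\<gamma> v x) = - \<gamma> v (\<gamma> u x)"
    and "sorted_wrt (\<lambda>u v. u \<bullet> v = 0) us" "\<forall>u \<in> set us. \<forall>x. \<gamma> u (\<gamma> u x) = x"
  shows "volume_action \<gamma> us (volume_action \<gamma> us x) = (- 1) ^ (length us choose 2) *\<^sub>R x"
  using assms(2,3)
proof (induction us)
  case (Cons u us)
  have "volume_action \<gamma> us (\<gamma> u y) = (- 1) ^ length us *\<^sub>R \<gamma> u (volume_action \<gamma> us y)" for y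
    using volume_commute[where \<gamma>=\<gamma>, OF anti, of us u y] Cons.prems by simp
  moreover have "volume_action \<gamma> (u # us) y = \<gamma> u (volume_action \<gamma> us y)" for y
    by (simp add: volume_action_def)
  ultimately show ?case
    using Cons by (simp add: blinfun.bilinear_simps power_add numeral_2_eq_2)
qed (simp add: volume_action_def numeral_2_eq_2)

text \<open>The volume element is a product of vectors, and these commute with the Schur algebra.\<close>

lemma volume_schur:
  assumes "T \<in> schur_algebra \<gamma>"
  shows "T (volume_action \<gamma> us x) = volume_action \<gamma> us (T x)"
proof (induction us)
  case (Cons u us)
  have "T (\<gamma> u y) = \<gamma> u (T y)" for y
    using assms by (metis (mono_tags, lifting) blinfun_apply_blinfun_compose mem_Collect_eq schur_algebra_def)
  then show ?case using Cons by (simp add: volume_action_def)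
qed (simp add: volume_action_def)

lemma orthonormal_list_spans:
  fixes us :: "'e::euclidean_space list"
  assumes "orthonormal_list us"
  shows "sorted_wrt (\<lambda>u v. u \<bullet> v = 0) us" "\<forall>u \<in> set us. u \<bullet> u = 1" "span (set us) = UNIV"
proof -
  have inner: "us ! i \<bullet> us ! j = (if i = j then 1 else 0)"
    if "i < length us" "j < length us" for i j
  proof -
    have "neg_inner (us ! i) (us ! j) = (if i = j then - 1 else 0)"
      using assms that by (simp add: orthonormal_list_def)
    then show ?thesis by (auto simp: neg_inner_def split: if_splits)
  qed
  show "sorted_wrt (\<lambda>u v. u \<bullet> v = 0) us"
    using inner by (simp add: sorted_wrt_iff_nth_less)
  show unit: "\<forall>u \<in> set us. u \<bullet> u = 1"
    using inner by (auto simp: in_set_conv_nth)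
  have "distinct us"
    unfolding distinct_conv_nth
  proof (intro allI impI)
    fix i j assume "i < length us" "j < length us" "i \<noteq> j"
    then show "us ! i \<noteq> us ! j" using inner[of i i] inner[of i j] by auto
  qed
  then have card: "card (set us) = DIM('e)"
    using assms by (simp add: distinct_card orthonormal_list_def)
  have "pairwise orthogonal (set us)"
    using inner by (auto simp: pairwise_def orthogonal_def in_set_conv_nth)
  moreover have "0 \<notin> set us"
    using unit by auto
  ultimately have indep: "independent (set us)"
    by (rule pairwise_orthogonal_independent)
  then show "span (set us) = UNIV"
    using card dim_eq_full[of "set us"] dim_eq_card_independent[OF indep] by simp
qed

lemma clifford_module_neg_inner:
  assumes "clifford_module neg_inner \<gamma>"
  shows "linear \<gamma>" "\<gamma> v (\<gamma> v x) = (v \<bullet> v) *\<^sub>R x"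
  using assms unfolding clifford_module_def neg_inner_def
  by (auto simp: blinfun.bilinear_simps simp flip: blinfun_apply_blinfun_compose)

lemma clifford_anticommute:
  assumes "clifford_module neg_inner \<gamma>" "u \<bullet> v = 0"
  shows "\<gamma> u (\<gamma> v x) = - \<gamma> v (\<gamma> u x)"
proof -
  note lin = clifford_module_neg_inner(1)[OF assms(1)]
    and square = clifford_module_neg_inner(2)[OF assms(1)]
  have "\<gamma> (u + v) (\<gamma> (u + v) x) = (u \<bullet> u + v \<bullet> v) *\<^sub>R x"
    using assms(2) by (simp add: square inner_add_left inner_add_right inner_commute)
  then have "\<gamma> v (\<gamma> u x) + \<gamma> u (\<gamma> v x) = 0"
    by (simp add: linear_add[OF lin] square blinfun.add_left blinfun.add_right scaleR_add_left)
  then show ?thesis by (simp add: eq_neg_iff_add_eq_0 add.commute)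
qed

text \<open>For \<open>n = 8 m + 4\<close> factors, \<open>n\<close> is even, so the volume element anticommutes with vectors, and \<open>n (n - 1) / 2\<close>
is even, so its square is the identity.\<close>

lemma quaternionic_spinors_volume:
  fixes \<gamma> :: "'e::euclidean_space \<Rightarrow> ('s::euclidean_space \<Rightarrow>\<^sub>L 's)"
  assumes dim: "DIM('e) mod 8 = 4" and cliff: "clifford_module neg_inner \<gamma>"
    and es: "orthonormal_list es" and \<iota>: "quat_identification \<iota> (schur_algebra \<gamma>)"
  shows "quaternionic_spinors \<gamma> (volume_action \<gamma> es) \<iota>"
proof (rule quaternionic_spinors.intro)
  show lin: "linear \<gamma>" by (rule clifford_module_neg_inner(1)[OF cliff])
  show square: "\<gamma> v (\<gamma> v x) = (v \<bullet> v) *\<^sub>R x" for v x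
    by (rule clifford_module_neg_inner(2)[OF cliff])
  note es' = orthonormal_list_spans[OF es]
  note anti = clifford_anticommute[OF cliff]
  obtain m where m: "length es = 8 * m + 4"
    using es dim unfolding orthonormal_list_def by (metis mult_div_mod_eq)
  have "length es * (length es - 1) = 2 * (2 * ((2 * m + 1) * (8 * m + 3)))"
    by (simp add: m algebra_simps)
  then have "even (length es choose 2)"
    by (simp add: choose_two)
  then show "volume_action \<gamma> es (volume_action \<gamma> es x) = x" for x
    using volume_square[where \<gamma>=\<gamma>, OF anti es'(1)] es'(2) square by simp
  show "volume_action \<gamma> es (\<gamma> v x) = - \<gamma> v (volume_action \<gamma> es x)" for v x
  proof -
    have "v \<in> span (set es)" using es'(3) by simp
    then show ?thesis
    proof (induction rule: span_induct_alt)
      case base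
      then show ?case by (simp add: linear_0[OF lin] blinfun.bilinear_simps)
    next
      case (step c u v)
      then show ?case
        using volume_commute_member[where \<gamma>=\<gamma>, OF anti es'(1) step(1)]
        by (simp add: m linear_add[OF lin] linear_scale[OF lin] blinfun.bilinear_simps)
    qed
  qed
  show "T (volume_action \<gamma> es x) = volume_action \<gamma> es (T x)" if "T \<in> schur_algebra \<gamma>" for T x
    by (rule volume_schur[OF that])
  show "quat_identification \<iota> (schur_algebra \<gamma>)" by (rule \<iota>)
  show "3 \<le> DIM('e)" using mod_less_eq_dividend[of "DIM('e)" 8] dim by linarith
qed

section \<open>Block matrices and spin representations\<close>

lemma blinfun_of_linear:
  fixes F :: "'a::euclidean_space \<Rightarrow> 'b::euclidean_space"
  assumes "linear F" obtains A :: "'a \<Rightarrow>\<^sub>L 'b" where "\<And>x. blinfun_apply A x = F x"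
  using assms that[of "Blinfun F"]
  by (simp add: bounded_linear_Blinfun_apply linear_conv_bounded_linear)

lemma has_blocks_exists:
  assumes "linear \<Phi>" "bij \<Phi>"
  shows "\<exists>A B C D. has_blocks \<Phi> T A B C D"
proof -
  obtain \<Psi> where \<Psi>: "linear \<Psi>" "\<Psi> \<circ> \<Phi> = id"
    using linear_injective_left_inverse[OF assms(1)] assms(2) bij_is_inj by blast
  have \<Phi>\<Psi>: "\<Phi> (\<Psi> z) = z" for z
    using \<Psi>(2) assms(2) by (metis bij_pointE comp_apply id_apply)
  define M where "M = (\<lambda>z. \<Psi> (T (\<Phi> z)))"
  have "linear T"
    by (auto intro!: linearI simp: blinfun.bilinear_simps)
  then have M: "linear M"
    unfolding M_def using linear_compose[OF linear_compose[OF assms(1)] \<Psi>(1)]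
    by (simp add: o_def)
  have "linear (\<lambda>x. fst (M (x, 0)))" "linear (\<lambda>y. fst (M (0, y)))"
    "linear (\<lambda>x. snd (M (x, 0)))" "linear (\<lambda>y. snd (M (0, y)))"
    using linear_add[OF M, of "(_, 0)" "(_, 0)"] linear_add[OF M, of "(0, _)" "(0, _)"]
      linear_scale[OF M, of _ "(_, 0)"] linear_scale[OF M, of _ "(0, _)"]
    by (auto intro!: linearI)
  then obtain A B C D where
    "\<And>x. blinfun_apply A x = fst (M (x, 0))" "\<And>y. blinfun_apply B y = fst (M (0, y))"
    "\<And>x. blinfun_apply C x = snd (M (x, 0))" "\<And>y. blinfun_apply D y = snd (M (0, y))"
    by (elim blinfun_of_linear) blast
  then have "M (x, y) = (A x + B y, C x + D y)" for x y
    using linear_add[OF M, of "(x, 0)" "(0, y)"] by (simp add: prod_eq_iff)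
  then have "T (\<Phi> (x, y)) = \<Phi> (A x + B y, C x + D y)" for x y
    unfolding M_def by (metis \<Phi>\<Psi>)
  then show ?thesis unfolding has_blocks_def by blast
qed

lemma has_blocks_unique:
  assumes "linear \<Phi>" "bij \<Phi>" "has_blocks \<Phi> T A B C D" "has_blocks \<Phi> T A' B' C' D'"
  shows "A = A'" "B = B'" "C = C'" "D = D'"
proof -
  have eq: "(A x + B y, C x + D y) = (A' x + B' y, C' x + D' y)" for x y
    using assms(2-4) unfolding has_blocks_def by (metis bij_is_inj injD)
  show "A = A'" "C = C'"
    using eq[of _ 0] by (auto intro!: blinfun_eqI simp: blinfun.bilinear_simps)
  show "B = B'" "D = D'"
    using eq[of 0] by (auto intro!: blinfun_eqI simp: blinfun.bilinear_simps)
qed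

lemma has_blocks_compose:
  assumes "has_blocks \<Phi> T A B C D" "has_blocks \<Phi> T' A' B' C' D'"
  shows "has_blocks \<Phi> (T o\<^sub>L T') ((A o\<^sub>L A') + (B o\<^sub>L C')) ((A o\<^sub>L B') + (B o\<^sub>L D'))
    ((C o\<^sub>L A') + (D o\<^sub>L C')) ((C o\<^sub>L B') + (D o\<^sub>L D'))"
  using assms unfolding has_blocks_def by (simp add: blinfun.bilinear_simps algebra_simps)

lemma has_blocks_add:
  assumes "linear \<Phi>" "has_blocks \<Phi> T A B C D" "has_blocks \<Phi> T' A' B' C' D'"
  shows "has_blocks \<Phi> (T + T') (A + A') (B + B') (C + C') (D + D')"
  using assms(2,3) unfolding has_blocks_def
  by (simp add: blinfun.bilinear_simps linear_add[OF assms(1), symmetric] algebra_simps)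

lemma has_blocks_scale:
  assumes "linear \<Phi>" "has_blocks \<Phi> T A B C D"
  shows "has_blocks \<Phi> (c *\<^sub>R T) (c *\<^sub>R A) (c *\<^sub>R B) (c *\<^sub>R C) (c *\<^sub>R D)"
  using assms(2) unfolding has_blocks_def
  by (simp add: blinfun.bilinear_simps linear_scale[OF assms(1), symmetric] scaleR_add_right)

lemma has_blocks_diff:
  assumes "linear \<Phi>" "has_blocks \<Phi> T A B C D" "has_blocks \<Phi> T' A' B' C' D'"
  shows "has_blocks \<Phi> (T - T') (A - A') (B - B') (C - C') (D - D')"
  using has_blocks_add[OF assms(1,2) has_blocks_scale[OF assms(1,3), of "- 1"]] by simp

lemma heis_bracket_without_dual:
  fixes b :: "'e::euclidean_space \<Rightarrow> 'e \<Rightarrow> real"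
  assumes "bilinear b"
  shows "heis_bracket b (heis_vec e) (heis_vec f) = 0" "heis_bracket b heis_p (heis_vec f) = 0"
proof -
  have "inv flat 0 = (0 :: 'e)"
    by (rule inv_f_eq[OF inj_flat]) (simp add: blinfun_eqI neg_inner_def)
  then show "heis_bracket b (heis_vec e) (heis_vec f) = 0" "heis_bracket b heis_p (heis_vec f) = 0"
    using assms
    by (simp_all add: heis_bracket_def heis_vec_def heis_p_def bilinear_lzero zero_prod_def)
qed

text \<open>Since \<open>b\<close> is non-degenerate, \<open>B\<close> is onto, and the bracket relation of the dual vectors with the vectors
becomes an identity between \<open>\<gamma> u\<close> for an arbitrary vector \<open>u\<close> and the blocks of \<open>\<rho>(f)\<close>.  Taking \<open>u \<noteq> 0\<close>
orthogonal to \<open>f\<close> shows that the lower left block of \<open>\<rho>(f)\<close> vanishes; then \<open>\<rho>(p)\<close> has only an upper right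
block, \<open>sqrt 2 H\<close>.  The upper right block of \<open>[\<rho>(e), \<rho>(f)] = 0\<close> is the suitability of \<open>c\<close>.\<close>

lemma spin_representation_blocks:
  fixes \<gamma> :: "'e::euclidean_space \<Rightarrow> ('s::euclidean_space \<Rightarrow>\<^sub>L 's)"
    and \<Phi> :: "'s \<times> 's \<Rightarrow> 't::euclidean_space"
  assumes \<gamma>: "clifford_module neg_inner \<gamma>" and dim: "2 \<le> DIM('e)"
    and b: "nondegenerate_symmetric_form b"
    and B: "linear B" "\<And>e f. b e f = - neg_inner (B e) f"
    and \<Phi>: "linear \<Phi>" "bij \<Phi>"
    and spin: "spin_representation \<gamma> \<Phi> b B \<rho>"
  obtains a c g H where "linear a" "suitable a g c"
    "has_blocks \<Phi> (\<rho> heis_p) 0 (sqrt 2 *\<^sub>R H) 0 0"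
    "\<And>f. has_blocks \<Phi> (\<rho> (heis_vec f)) (a f) (c f) 0 (g f)"
    "\<And>e f x. \<gamma> e (g f x) - a f (\<gamma> e x) = (e \<bullet> f) *\<^sub>R H x"
    "\<And>f x. H (g f x) = a f (H x)"
    "\<And>e f x. a e (a f x) = a f (a e x)"
proof -
  have bil: "bilinear b" and nondeg: "\<And>x. (\<forall>y. b x y = 0) \<Longrightarrow> x = 0"
    using b by (auto simp: nondegenerate_symmetric_form_def)
  have rep: "linear \<rho>" "\<And>x y. \<rho> (heis_bracket b x y) = (\<rho> x o\<^sub>L \<rho> y) - (\<rho> y o\<^sub>L \<rho> x)"
    and dual: "\<And>e. has_blocks \<Phi> (\<rho> (heis_dual e)) 0 (sqrt 2 *\<^sub>R \<gamma> (B e)) 0 0"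
    using spin by (auto simp: spin_representation_def heis_representation_def)
  have b_inner: "b e f = B e \<bullet> f" for e f
    by (simp add: B(2) neg_inner_def)
  have "surj B"
  proof (rule linear_injective_imp_surjective[OF B(1)])
    show "inj B"
      using nondeg by (simp add: linear_injective_0[OF B(1)] b_inner)
  qed (rule refl)
  note unique = has_blocks_unique[OF \<Phi>]
  obtain P0 P P1 P2 where P: "has_blocks \<Phi> (\<rho> heis_p) P0 P P1 P2"
    using has_blocks_exists[OF \<Phi>] by blast
  have "\<forall>f. \<exists>A C D G. has_blocks \<Phi> (\<rho> (heis_vec f)) A C D G"
    by (intro allI has_blocks_exists[OF \<Phi>])
  then obtain a c d g where vec: "\<And>f. has_blocks \<Phi> (\<rho> (heis_vec f)) (a f) (c f) (d f) (g f)"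
    unfolding choice_iff by blast
  have zero: "has_blocks \<Phi> 0 0 0 0 0"
    by (simp add: has_blocks_def linear_0[OF \<Phi>(1)] flip: zero_prod_def)
  have dual_vec: "(u \<bullet> f) *\<^sub>R P0 = sqrt 2 *\<^sub>R (\<gamma> u o\<^sub>L d f)"
    "(u \<bullet> f) *\<^sub>R P = sqrt 2 *\<^sub>R ((\<gamma> u o\<^sub>L g f) - (a f o\<^sub>L \<gamma> u))"
    "(u \<bullet> f) *\<^sub>R P1 = 0"
    "(u \<bullet> f) *\<^sub>R P2 = - (sqrt 2 *\<^sub>R (d f o\<^sub>L \<gamma> u))" for u f
  proof -
    obtain e where u: "u = B e" using \<open>surj B\<close> by (metis surjD)
    have "(u \<bullet> f) *\<^sub>R \<rho> heis_p
        = (\<rho> (heis_dual e) o\<^sub>L \<rho> (heis_vec f)) - (\<rho> (heis_vec f) o\<^sub>L \<rho> (heis_dual e))"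
      by (simp add: heis_bracket_dual_vec[OF bil] linear_scale[OF rep(1)] b_inner u flip: rep(2))
    with has_blocks_diff[OF \<Phi>(1) has_blocks_compose[OF dual[of e] vec[of f]]
        has_blocks_compose[OF vec[of f] dual[of e]]]
    have comm: "has_blocks \<Phi> ((u \<bullet> f) *\<^sub>R \<rho> heis_p) (sqrt 2 *\<^sub>R (\<gamma> u o\<^sub>L d f))
        (sqrt 2 *\<^sub>R ((\<gamma> u o\<^sub>L g f) - (a f o\<^sub>L \<gamma> u))) 0 (- (sqrt 2 *\<^sub>R (d f o\<^sub>L \<gamma> u)))"
      unfolding has_blocks_def u by (simp add: blinfun.bilinear_simps scaleR_diff_right)
    from unique[OF has_blocks_scale[OF \<Phi>(1) P] comm]
    show "(u \<bullet> f) *\<^sub>R P0 = sqrt 2 *\<^sub>R (\<gamma> u o\<^sub>L d f)"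
      "(u \<bullet> f) *\<^sub>R P = sqrt 2 *\<^sub>R ((\<gamma> u o\<^sub>L g f) - (a f o\<^sub>L \<gamma> u))"
      "(u \<bullet> f) *\<^sub>R P1 = 0" "(u \<bullet> f) *\<^sub>R P2 = - (sqrt 2 *\<^sub>R (d f o\<^sub>L \<gamma> u))"
      by simp_all
  qed
  have d: "d f = 0" for f
  proof -
    obtain u where u: "u \<noteq> 0" "u \<bullet> f = 0"
      using orthogonal_to_vector_exists[OF dim, of f] by (auto simp: orthogonal_def inner_commute)
    have "\<gamma> u (d f x) = 0" for x
      using arg_cong[OF dual_vec(1)[of u f], of "\<lambda>T. blinfun_apply T x"] u
      by (simp add: blinfun.bilinear_simps)
    then have "(u \<bullet> u) *\<^sub>R d f x = 0" for x
      by (simp add: blinfun.bilinear_simps flip: clifford_module_neg_inner(2)[OF \<gamma>])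
    then show ?thesis using u by (intro blinfun_eqI) simp
  qed
  obtain n :: 'e where n: "n \<bullet> n \<noteq> 0"
    using orthogonal_to_vector_exists[OF dim, of 0] by auto
  have P012: "P0 = 0" "P1 = 0" "P2 = 0"
    using dual_vec(1,3,4)[of n n] n by (simp_all add: d)
  have P': "has_blocks \<Phi> (\<rho> heis_p) 0 P 0 0" using P by (simp add: P012)
  have vec': "has_blocks \<Phi> (\<rho> (heis_vec f)) (a f) (c f) 0 (g f)" for f
    using vec[of f] by (simp add: d)
  define H where "H = (1 / sqrt 2) *\<^sub>R P"
  have P_H: "P = sqrt 2 *\<^sub>R H" by (simp add: H_def)
  have mixed: "\<gamma> e (g f x) - a f (\<gamma> e x) = (e \<bullet> f) *\<^sub>R H x" for e f x
  proof -
    have "(e \<bullet> f) *\<^sub>R H = (1 / sqrt 2) *\<^sub>R ((e \<bullet> f) *\<^sub>R P)" by (simp add: H_def)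
    then have "(e \<bullet> f) *\<^sub>R H = (\<gamma> e o\<^sub>L g f) - (a f o\<^sub>L \<gamma> e)" unfolding dual_vec(2) by simp
    from arg_cong[OF this, of "\<lambda>T. blinfun_apply T x"] show ?thesis
      by (simp add: blinfun.bilinear_simps)
  qed
  have comm0: "has_blocks \<Phi> 0 ((a e o\<^sub>L a f) - (a f o\<^sub>L a e))
      (((a e o\<^sub>L c f) + (c e o\<^sub>L g f)) - ((a f o\<^sub>L c e) + (c f o\<^sub>L g e))) 0
      ((g e o\<^sub>L g f) - (g f o\<^sub>L g e))" for e f
  proof -
    have "(\<rho> (heis_vec e) o\<^sub>L \<rho> (heis_vec f)) - (\<rho> (heis_vec f) o\<^sub>L \<rho> (heis_vec e)) = 0"
      by (simp add: heis_bracket_without_dual(1)[OF bil] linear_0[OF rep(1)] flip: rep(2))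
    with has_blocks_diff[OF \<Phi>(1) has_blocks_compose[OF vec'[of e] vec'[of f]]
        has_blocks_compose[OF vec'[of f] vec'[of e]]]
    show ?thesis by simp
  qed
  have comm: "a e (a f x) = a f (a e x)" for e f x
    using arg_cong[OF unique(1)[OF comm0 zero, of e f], of "\<lambda>T. blinfun_apply T x"]
    by (simp add: blinfun.bilinear_simps)
  have suit: "(a e o\<^sub>L c f) - (c f o\<^sub>L g e) = (a f o\<^sub>L c e) - (c e o\<^sub>L g f)" for e f
    using unique(2)[OF comm0 zero, of e f] by (simp add: algebra_simps)
  have central: "H (g f x) = a f (H x)" for f x
  proof -
    have "(\<rho> heis_p o\<^sub>L \<rho> (heis_vec f)) - (\<rho> (heis_vec f) o\<^sub>L \<rho> heis_p) = 0"
      by (simp add: heis_bracket_without_dual(2)[OF bil] linear_0[OF rep(1)] flip: rep(2))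
    with has_blocks_diff[OF \<Phi>(1) has_blocks_compose[OF P' vec'[of f]]
        has_blocks_compose[OF vec'[of f] P']]
    have "has_blocks \<Phi> 0 0 ((P o\<^sub>L g f) - (a f o\<^sub>L P)) 0 0" by simp
    from arg_cong[OF unique(2)[OF this zero], of "\<lambda>T. blinfun_apply T x"]
    have "P (g f x) = a f (P x)" by (simp add: blinfun.bilinear_simps)
    then show ?thesis by (simp add: H_def blinfun.bilinear_simps)
  qed
  have vec_add: "heis_vec (e + f) = heis_vec e + heis_vec f" for e f :: 'e
    by (simp add: heis_vec_def)
  have vec_scale: "heis_vec (r *\<^sub>R e) = r *\<^sub>R heis_vec e" for r and e :: 'e
    by (simp add: heis_vec_def)
  have lin: "linear a" "linear c"
  proof -
    have sum: "has_blocks \<Phi> (\<rho> (heis_vec (e + f))) (a e + a f) (c e + c f) (0 + 0) (g e + g f)" for e f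
      unfolding vec_add linear_add[OF rep(1)] by (rule has_blocks_add[OF \<Phi>(1) vec' vec'])
    have scale: "has_blocks \<Phi> (\<rho> (heis_vec (r *\<^sub>R e))) (r *\<^sub>R a e) (r *\<^sub>R c e) (r *\<^sub>R 0) (r *\<^sub>R g e)" for r e
      unfolding vec_scale linear_scale[OF rep(1)] by (rule has_blocks_scale[OF \<Phi>(1) vec'])
    show "linear a" "linear c"
      using unique(1,2)[OF vec' sum] unique(1,2)[OF vec' scale] by (auto intro!: linearI)
  qed
  have "suitable a g c"
    unfolding suitable_def using lin(2) suit by blast
  then show thesis
    using that[OF lin(1) _ P'[unfolded P_H] vec' mixed central comm] by blast
qed

section \<open>The classification\<close>

theorem theorem2p18:
  fixes b :: "'e::euclidean_space \<Rightarrow> 'e \<Rightarrow> real"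
    and B :: "'e \<Rightarrow> 'e"
    and \<gamma> :: "'e \<Rightarrow> ('s::euclidean_space \<Rightarrow>\<^sub>L 's)"
    and \<Gamma> :: "'e mink \<Rightarrow> ('t::euclidean_space \<Rightarrow>\<^sub>L 't)"
    and \<Phi> :: "'s \<times> 's \<Rightarrow> 't"
    and es :: "'e list"
    and \<E> :: "'s \<Rightarrow>\<^sub>L 's"
    and \<iota> :: "quat \<Rightarrow> ('s \<Rightarrow>\<^sub>L 's)"
    and \<rho> :: "'e heis \<Rightarrow> ('t \<Rightarrow>\<^sub>L 't)"
  assumes dim_E: "DIM('e) mod 8 = 4"
    and b: "nondegenerate_symmetric_form b"
    and B: "linear B" "\<And>e f. b e f = - neg_inner (B e) f"
    and S_E: "irreducible_clifford_module neg_inner \<gamma>"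
    and volume: "orthonormal_list es" "\<E> = volume_action \<gamma> es"
    and quaternions: "quat_identification \<iota> (schur_algebra \<gamma>)"
    and S_mink: "irreducible_clifford_module mink_inner \<Gamma>"
    and splitting: "spinor_splitting \<gamma> \<Gamma> \<Phi>"
    and spin: "spin_representation \<gamma> \<Phi> b B \<rho>"
    and charge: "\<rho> heis_p \<noteq> 0"
  shows "\<exists>(\<epsilon>::real) (h1::quat) (h3 :: 'e \<Rightarrow> quat) (h4 :: 'e \<Rightarrow> quat) \<rho>11 \<rho>12 \<rho>22.
    \<epsilon> \<in> {1, -1} \<and>
    has_blocks \<Phi> (\<rho> heis_p) 0 (sqrt 2 *\<^sub>R (\<iota> h1 o\<^sub>L (id_blinfun + \<epsilon> *\<^sub>R \<E>))) 0 0 \<and>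
    (\<forall>e. has_blocks \<Phi> (\<rho> (heis_vec e)) (\<rho>11 e) (\<rho>12 e) 0 (\<rho>22 e)) \<and>
    (\<forall>e. \<rho>11 e = (1 / 2) *\<^sub>R
       (\<iota> (h3 e) - (\<iota> h1 o\<^sub>L \<gamma> e) + \<epsilon> *\<^sub>R (\<iota> h1 o\<^sub>L \<gamma> e o\<^sub>L \<E>) - (\<iota> (h4 e) o\<^sub>L \<E>))) \<and>
    (\<forall>e. \<rho>22 e = (1 / 2) *\<^sub>R
       (\<iota> (h3 e) + (\<iota> h1 o\<^sub>L \<gamma> e) + \<epsilon> *\<^sub>R (\<iota> h1 o\<^sub>L \<gamma> e o\<^sub>L \<E>) + (\<iota> (h4 e) o\<^sub>L \<E>))) \<and>
    suitable \<rho>11 \<rho>22 \<rho>12 \<and>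
    ((quat_Re h1 \<noteq> 0 \<and>
      linear h3 \<and> dim (range (\<lambda>e. quat_Im (h3 e))) \<le> 1 \<and>
      (\<forall>e. h4 e = (0, (- \<epsilon> / quat_Re h1) *\<^sub>R cross3 (quat_Im h1) (quat_Im (h3 e)))))
     \<or>
     (quat_Re h1 = 0 \<and> quat_Im h1 \<noteq> 0 \<and>
      (\<exists>(h3R :: 'e \<Rightarrow> real) (h3C :: 'e \<Rightarrow> real) (h4R :: 'e \<Rightarrow> real) (w :: real ^ 3).
        linear h3R \<and> linear h3C \<and>
        (\<forall>e. h3 e = (h3R e, h3C e *\<^sub>R (quat_Im h1 /\<^sub>R norm (quat_Im h1)))) \<and>
        linear h4R \<and> w \<noteq> 0 \<and> w \<bullet> quat_Im h1 = 0 \<and>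
        (\<forall>e. h4 e = (0, h4R e *\<^sub>R w)) \<and>
        ((\<exists>e. h3C e \<noteq> 0) \<and> (\<exists>e. h4R e \<noteq> 0) \<longrightarrow> {e. h4R e = 0} = {e. h3C e = 0}))))"
proof -
  have cliff: "clifford_module neg_inner \<gamma>"
    using S_E by (simp add: irreducible_clifford_module_def)
  interpret quaternionic_spinors \<gamma> \<E> \<iota>
    unfolding volume(2) by (rule quaternionic_spinors_volume[OF dim_E cliff volume(1) quaternions])
  have \<Phi>: "linear \<Phi>" "bij \<Phi>"
    using splitting by (auto simp: spinor_splitting_def)
  have "2 \<le> DIM('e)" using dim_ge_3 by linarith
  then obtain a c g H where lin: "linear a" and suit: "suitable a g c"
    and P: "has_blocks \<Phi> (\<rho> heis_p) 0 (sqrt 2 *\<^sub>R H) 0 0"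
    and vec: "\<And>f. has_blocks \<Phi> (\<rho> (heis_vec f)) (a f) (c f) 0 (g f)"
    and mixed: "\<And>e f x. \<gamma> e (g f x) - a f (\<gamma> e x) = (e \<bullet> f) *\<^sub>R H x"
    and central: "\<And>f x. H (g f x) = a f (H x)"
    and comm: "\<And>e f x. a e (a f x) = a f (a e x)"
    by (rule spin_representation_blocks[OF cliff _ b B \<Phi> spin]) (rule that; assumption)
  have H0: "H \<noteq> 0"
  proof
    assume "H = 0"
    then have "\<rho> heis_p (\<Phi> (x, y)) = 0" for x y
      using P linear_0[OF \<Phi>(1)] by (simp add: has_blocks_def zero_prod_def)
    then have "\<rho> heis_p z = 0" for z
      using bij_is_surj[OF \<Phi>(2)] by (metis surjD surj_pair)
    then show False using charge by (auto intro: blinfun_eqI)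
  qed
  obtain \<epsilon> :: real and h p q where \<epsilon>: "\<epsilon> \<in> {1, - 1}" and h: "h \<noteq> 0" and pq: "linear p" "linear q"
    and H: "\<And>x. H x = \<iota> h x + \<E> (\<iota> (\<epsilon> *\<^sub>R h) x)"
    and a: "\<And>f x. 2 *\<^sub>R a f x
      = \<iota> (p f) x - \<gamma> f (\<iota> h x) + \<gamma> f (\<E> (\<iota> (\<epsilon> *\<^sub>R h) x)) - \<E> (\<iota> (q f) x)"
    and g: "\<And>f x. 2 *\<^sub>R g f x
      = \<iota> (p f) x + \<gamma> f (\<iota> h x) + \<gamma> f (\<E> (\<iota> (\<epsilon> *\<^sub>R h) x)) + \<E> (\<iota> (q f) x)"
    and rel: "\<And>f. quat_mult h (p f) - quat_mult (p f) h
      + \<epsilon> *\<^sub>R (quat_mult h (q f) + quat_mult (q f) h) = 0"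
    and pp: "\<And>e f. (quat_mult (p e) (p f) - quat_mult (p f) (p e))
      + (quat_mult (q e) (q f) - quat_mult (q f) (q e)) = 0"
    and pq': "\<And>e f. (quat_mult (p e) (q f) - quat_mult (q f) (p e))
      + (quat_mult (q e) (p f) - quat_mult (p f) (q e)) = 0"
    by (rule heisenberg_diagonal_blocks[OF lin H0 mixed central comm]) (rule that; assumption)
  have "\<epsilon> * \<epsilon> = 1" using \<epsilon> by auto
  note solutions = quaternion_solutions[OF h this pq rel pp pq']
  have H_form: "H = \<iota> h o\<^sub>L (id_blinfun + \<epsilon> *\<^sub>R \<E>)"
    by (rule blinfun_eqI) (simp add: H \<iota>_scale \<iota>_\<omega> blinfun.bilinear_simps)
  have a_form: "a e = (1 / 2) *\<^sub>R
      (\<iota> (p e) - (\<iota> h o\<^sub>L \<gamma> e) + \<epsilon> *\<^sub>R (\<iota> h o\<^sub>L \<gamma> e o\<^sub>L \<E>) - (\<iota> (q e) o\<^sub>L \<E>))" for e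
  proof (rule blinfun_eqI)
    fix x
    have "a e x = (1 / 2) *\<^sub>R (2 *\<^sub>R a e x)" by simp
    also have "\<dots> = ((1 / 2) *\<^sub>R
      (\<iota> (p e) - (\<iota> h o\<^sub>L \<gamma> e) + \<epsilon> *\<^sub>R (\<iota> h o\<^sub>L \<gamma> e o\<^sub>L \<E>) - (\<iota> (q e) o\<^sub>L \<E>))) x"
      unfolding a by (simp add: \<iota>_scale \<iota>_\<gamma> \<iota>_\<omega> blinfun.bilinear_simps)
    finally show "a e x = \<dots>" .
  qed
  have g_form: "g e = (1 / 2) *\<^sub>R
      (\<iota> (p e) + (\<iota> h o\<^sub>L \<gamma> e) + \<epsilon> *\<^sub>R (\<iota> h o\<^sub>L \<gamma> e o\<^sub>L \<E>) + (\<iota> (q e) o\<^sub>L \<E>))" for e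
  proof (rule blinfun_eqI)
    fix x
    have "g e x = (1 / 2) *\<^sub>R (2 *\<^sub>R g e x)" by simp
    also have "\<dots> = ((1 / 2) *\<^sub>R
      (\<iota> (p e) + (\<iota> h o\<^sub>L \<gamma> e) + \<epsilon> *\<^sub>R (\<iota> h o\<^sub>L \<gamma> e o\<^sub>L \<E>) + (\<iota> (q e) o\<^sub>L \<E>))) x"
      unfolding g by (simp add: \<iota>_scale \<iota>_\<gamma> \<iota>_\<omega> blinfun.bilinear_simps)
    finally show "g e x = \<dots>" .
  qed
  show ?thesis
    by (intro exI[of _ \<epsilon>] exI[of _ h] exI[of _ p] exI[of _ q] exI[of _ a] exI[of _ c] exI[of _ g]
        conjI allI \<epsilon> P[unfolded H_form] vec a_form g_form suit solutions)
qed

end
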